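(* Let $X$ be a (non-empty) compact space and let $G$ be a topological subgroup of $H(X)$. For $g\in G$ let $\Gamma_g=\{(x,gx):x\in X\}\subset X^2$ be the graph of $g$, and let $R$ be the closure of the set $\{\Gamma_g: g\in G\}$ in the space $\mathrm{Exp}(X^2)$. Consider $\mathrm{Exp}(X^2)$ as a $G$-space with the action $gF=\{(x,gy):(x,y)\in F\}$ ($g\in G$, $F\in \mathrm{Exp}(X^2)$), consider $R$ as a $G$-subspace of $\mathrm{Exp}(X^2)$, and consider $\mathrm{Exp}\,R$ with the induced action of $G$. Then $G$ is extremely amenable if and only if every minimal closed $G$-subset of $\mathrm{Exp}\,R$ is a singleton.
   Context: All spaces are Tikhonov (in particular, compact spaces are Hausdorff), and topological groups are Hausdorff. For a compact space $X$, $H(X)$ is the group of all self-homeomorphisms of $X$ with the compact-open topology; subgroups carry the subspace topology. For a topological group $G$, a $G$-space is a topological space $Y$ with a (jointly) continuous action $G\times Y\to Y$, i.e. $g(hy)=(gh)y$ and $1y=y$. A closed $G$-subset (closed $G$-subspace) of $Y$ is a closed $G$-invariant subset. A non-empty closed $G$-subset is minimal if it has no proper non-empty closed $G$-invariant subsets (equivalently, every orbit in it is dense in it). $G$ is extremely amenable if every non-empty compact $G$-space $Y$ has a $G$-fixed point, i.e. a point $p\in Y$ with $gp=p$ for all $g\in G$. For a compact space $K$, $\mathrm{Exp}\,K$ is the compact space of all closed non-empty subsets of $K$ with the Vietoris topology: the topology for which the sets $\{A\in\mathrm{Exp}\,K: A\subset F\}$ and $\{A\in \mathrm{Exp}\,K: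 A\cap F\neq\emptyset\}$, $F$ closed in $K$, form a subbase of closed sets. If $K$ is a compact $G$-space, then $\mathrm{Exp}\,K$ is a compact $G$-space under $gA=\{ga:a\in A\}$. *)

theory Defs
  imports "HOL-Analysis.Analysis" "HOL-Algebra.Bij"
begin

no_notation eq_closure_of (\<open>closure'_of\<index>\<close>)

section \<open>G-spaces and extreme amenability\<close>

definition G_space ::
    "('g, 'm) monoid_scheme \<Rightarrow> 'g topology \<Rightarrow> 'y topology \<Rightarrow> ('g \<Rightarrow> 'y \<Rightarrow> 'y) \<Rightarrow> bool" where
  "G_space \<Gamma> T Y act \<longleftrightarrow>
     continuous_map (prod_topology T Y) Y (\<lambda>(g, y). act g y) \<and>
     (\<forall>g\<in>carrier \<Gamma>. \<forall>h\<in>carrier \<Gamma>. \<forall>y\<in>topspace Y. act g (act h y) = act (g \<otimes>\<^bsub>\<Gamma>\<^esub> h) y) \<and>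
     (\<forall>y\<in>topspace Y. act \<one>\<^bsub>\<Gamma>\<^esub> y = y)"

definition minimal_closed_G_subset ::
    "'g set \<Rightarrow> 'y topology \<Rightarrow> ('g \<Rightarrow> 'y \<Rightarrow> 'y) \<Rightarrow> 'y set \<Rightarrow> bool" where
  "minimal_closed_G_subset G Y act M \<longleftrightarrow>
     closedin Y M \<and> M \<noteq> {} \<and> (\<forall>g\<in>G. act g ` M \<subseteq> M) \<and>
     (\<forall>N. closedin Y N \<and> N \<noteq> {} \<and> (\<forall>g\<in>G. act g ` N \<subseteq> N) \<and> N \<subseteq> M \<longrightarrow> N = M)"

text \<open>
  HOL cannot quantify over compact spaces of all types inside a definition. It suffices to consider
  spaces whose points are sets of subsets of the group, since an orbit closure in a compact
  Hausdorff G-space embeds into that type: theorem \<open>extremely_amenable_fixed_point\<close> derives a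
  fixed point in compact G-spaces over an arbitrary type \<open>'y\<close>.
\<close>

definition extremely_amenable :: "('g, 'm) monoid_scheme \<Rightarrow> 'g topology \<Rightarrow> bool" where
  "extremely_amenable \<Gamma> T \<longleftrightarrow>
     (\<forall>(Y :: 'g set set topology) act.
        compact_space Y \<and> Hausdorff_space Y \<and> topspace Y \<noteq> {} \<and> G_space \<Gamma> T Y act \<longrightarrow>
        (\<exists>p\<in>topspace Y. \<forall>g\<in>carrier \<Gamma>. act g p = p))"

theorem extremely_amenable_fixed_point:
  fixes \<Gamma> :: "('g, 'm) monoid_scheme" and Y :: "'y topology"
  assumes ea: "extremely_amenable \<Gamma> T" and grp: "group \<Gamma>" and T: "topspace T = carrier \<Gamma>"
    and Y: "compact_space Y" "Hausdorff_space Y" "topspace Y \<noteq> {}"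
    and act: "G_space \<Gamma> T Y act"
  shows "\<exists>p\<in>topspace Y. \<forall>g\<in>carrier \<Gamma>. act g p = p"
proof -
  interpret group \<Gamma> by (rule grp)
  have cont: "continuous_map (prod_topology T Y) Y (\<lambda>(g, y). act g y)"
    and mult: "\<And>g h y. \<lbrakk>g \<in> carrier \<Gamma>; h \<in> carrier \<Gamma>; y \<in> topspace Y\<rbrakk>
                 \<Longrightarrow> act g (act h y) = act (g \<otimes>\<^bsub>\<Gamma>\<^esub> h) y"
    and one: "\<And>y. y \<in> topspace Y \<Longrightarrow> act \<one>\<^bsub>\<Gamma>\<^esub> y = y"
    using act by (auto simp: G_space_def)
  have act_in: "act g y \<in> topspace Y" if "g \<in> carrier \<Gamma>" "y \<in> topspace Y" for g y
    using funcset_mem[OF continuous_map_funspace[OF cont], of "(g, y)"] that T by simp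
  have cont_g: "continuous_map Y Y (act g)" if "g \<in> carrier \<Gamma>" for g
  proof -
    have "continuous_map Y (prod_topology T Y) (\<lambda>y. (g, y))"
      using that T by (intro continuous_map_pairedI) auto
    from continuous_map_compose[OF this cont] show ?thesis by (simp add: o_def)
  qed
  obtain y where y: "y \<in> topspace Y" using Y(3) by blast
  define orb where "orb A = (\<lambda>g. act g y) ` A" for A
  define Z where "Z = Y closure_of orb (carrier \<Gamma>)"
  have orb_sub: "orb A \<subseteq> topspace Y" if "A \<subseteq> carrier \<Gamma>" for A
    using that act_in y by (auto simp: orb_def)
  have Z_sub: "Z \<subseteq> topspace Y" by (simp add: Z_def closure_of_subset_topspace)
  have Z_closed: "closedin Y Z" by (simp add: Z_def)
  have Z_ne: "Z \<noteq> {}"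
  proof -
    have "orb (carrier \<Gamma>) \<subseteq> Z"
      unfolding Z_def by (rule closure_of_subset) (simp add: orb_sub)
    moreover have "orb (carrier \<Gamma>) \<noteq> {}" by (auto simp: orb_def)
    ultimately show ?thesis by auto
  qed
  have Z_inv: "act g z \<in> Z" if g: "g \<in> carrier \<Gamma>" and z: "z \<in> Z" for g z
  proof -
    have "act g ` orb (carrier \<Gamma>) \<subseteq> orb (carrier \<Gamma>)"
      using g mult y by (auto simp: orb_def)
    then have "Y closure_of (act g ` orb (carrier \<Gamma>)) \<subseteq> Z"
      unfolding Z_def by (rule closure_of_mono)
    then show ?thesis
      using continuous_map_image_closure_subset[OF cont_g[OF g], of "orb (carrier \<Gamma>)"] z
      unfolding Z_def by blast
  qed
  define code where "code z = {A. A \<subseteq> carrier \<Gamma> \<and> z \<in> Y closure_of (orb A)}" for z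
  have inj: "inj_on code Z"
  proof (rule inj_onI, rule ccontr)
    fix z w assume z: "z \<in> Z" and w: "w \<in> Z" and eq: "code z = code w" and ne: "z \<noteq> w"
    obtain U V where UV: "openin Y U" "openin Y V" "z \<in> U" "w \<in> V" "disjnt U V"
      using Y(2) z w ne Z_sub unfolding Hausdorff_space_def by (meson subsetD)
    define A where "A = {g \<in> carrier \<Gamma>. act g y \<in> U}"
    have "z \<in> Y closure_of (orb A)"
      unfolding in_closure_of
    proof (intro conjI allI impI)
      show "z \<in> topspace Y" using z Z_sub by auto
      fix W assume W: "z \<in> W \<and> openin Y W"
      have "\<exists>v. v \<in> orb (carrier \<Gamma>) \<and> v \<in> W \<inter> U"
        using z W UV openin_Int[of Y W U] unfolding Z_def in_closure_of by blast
      then show "\<exists>v. v \<in> orb A \<and> v \<in> W"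
        by (auto simp: orb_def A_def)
    qed
    then have "A \<in> code w" unfolding eq[symmetric] by (simp add: code_def A_def)
    then have "w \<in> Y closure_of (orb A)" by (simp add: code_def)
    then obtain v where "v \<in> orb A" "v \<in> V"
      using UV unfolding in_closure_of by blast
    then show False using UV(5) by (auto simp: orb_def A_def disjnt_def)
  qed
  define d where "d = inv_into Z code"
  have d_code: "\<And>z. z \<in> Z \<Longrightarrow> d (code z) = z" using inj by (simp add: d_def)
  have d_in: "\<And>s. s \<in> code ` Z \<Longrightarrow> d s \<in> Z" by (auto simp: d_code)
  have code_d: "\<And>s. s \<in> code ` Z \<Longrightarrow> code (d s) = s" by (auto simp: d_code)
  define Z' where "Z' = subtopology Y Z"
  have tZ: "topspace Z' = Z" using Z_sub by (auto simp: Z'_def)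
  define Y' where "Y' = pullback_topology (code ` Z) d Z'"
  have tY': "topspace Y' = code ` Z"
    by (auto simp: Y'_def topspace_pullback_topology tZ d_code)
  have cd: "continuous_map Y' Z' d"
    using continuous_map_pullback[OF continuous_map_id, of "code ` Z" d Z'] by (simp add: Y'_def)
  have cc: "continuous_map Z' Y' code"
    unfolding Y'_def
  proof (rule continuous_map_pullback')
    have "continuous_map Z' Z' id" by simp
    then show "continuous_map Z' Z' (d \<circ> code)"
      by (rule continuous_map_eq) (simp add: tZ d_code)
    show "topspace Z' \<subseteq> code -` (code ` Z)" by (auto simp: tZ)
  qed
  have "homeomorphic_maps Z' Y' code d"
    using cd cc by (simp add: homeomorphic_maps_def tZ tY' d_code code_d)
  then have hom: "Z' homeomorphic_space Y'" by (auto simp: homeomorphic_space_def)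
  have "compact_space Z'"
    unfolding Z'_def using Y(1) Z_closed
    by (simp add: closedin_compact_space compact_space_subtopology)
  then have "compact_space Y'" using hom homeomorphic_compact_space by blast
  moreover have "Hausdorff_space Y'"
    using hom homeomorphic_Hausdorff_space Hausdorff_space_subtopology[OF Y(2)] Z'_def by blast
  moreover have "topspace Y' \<noteq> {}" using Z_ne by (simp add: tY')
  moreover have "G_space \<Gamma> T Y' (\<lambda>g s. code (act g (d s)))"
    unfolding G_space_def
  proof (intro conjI ballI)
    have dY: "continuous_map Y' Y d"
      using cd by (simp add: Z'_def continuous_map_in_subtopology)
    have "continuous_map (prod_topology T Y') (prod_topology T Y) (\<lambda>p. (fst p, d (snd p)))"
      by (intro continuous_map_pairedI continuous_map_fst
            continuous_map_compose[OF continuous_map_snd dY, unfolded o_def])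
    from continuous_map_compose[OF this cont]
    have "continuous_map (prod_topology T Y') Y (\<lambda>p. act (fst p) (d (snd p)))"
      by (simp add: o_def)
    then have "continuous_map (prod_topology T Y') Z' (\<lambda>p. act (fst p) (d (snd p)))"
      using T by (auto simp: Z'_def continuous_map_in_subtopology tY' d_code Z_inv)
    from continuous_map_compose[OF this cc]
    show "continuous_map (prod_topology T Y') Y' (\<lambda>(g, s). code (act g (d s)))"
      by (simp add: o_def case_prod_unfold)
  next
    fix g h s assume "g \<in> carrier \<Gamma>" "h \<in> carrier \<Gamma>" "s \<in> topspace Y'"
    then show "code (act g (d (code (act h (d s))))) = code (act (g \<otimes>\<^bsub>\<Gamma>\<^esub> h) (d s))"
      using d_in[of s] Z_sub by (auto simp: tY' d_code Z_inv mult subset_iff)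
  next
    fix s assume "s \<in> topspace Y'"
    then show "code (act \<one>\<^bsub>\<Gamma>\<^esub> (d s)) = s"
      using d_in[of s] Z_sub by (auto simp: tY' d_code one subset_iff)
  qed
  ultimately obtain s where s: "s \<in> topspace Y'" "\<forall>g\<in>carrier \<Gamma>. code (act g (d s)) = s"
    using ea unfolding extremely_amenable_def by blast
  have ds: "d s \<in> Z" using s d_in by (simp add: tY')
  have "act g (d s) = d s" if "g \<in> carrier \<Gamma>" for g
    using s(2) that d_code[OF Z_inv[OF that ds]] by simp
  then show ?thesis using ds Z_sub by blast
qed


section \<open>The homeomorphism group\<close>

text \<open>As in \<^const>\<open>BijGroup\<close>, self-maps of the space are extensional functions.\<close>

definition homeo_group :: "'a topology \<Rightarrow> ('a \<Rightarrow> 'a) monoid" where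
  "homeo_group X =
     (BijGroup (topspace X))\<lparr>carrier := {f \<in> Bij (topspace X). homeomorphic_map X X f}\<rparr>"

definition compact_open_topology :: "'a topology \<Rightarrow> ('a \<Rightarrow> 'a) topology" where
  "compact_open_topology X = topology_generated_by
     {{f \<in> carrier (homeo_group X). f ` K \<subseteq> U} | K U. compactin X K \<and> openin X U}"

lemma topspace_compact_open_topology:
  "topspace (compact_open_topology X) = carrier (homeo_group X)"
proof -
  have "carrier (homeo_group X) \<in>
      {{f \<in> carrier (homeo_group X). f ` K \<subseteq> U} | K U. compactin X K \<and> openin X U}"
    by (rule CollectI, rule exI[of _ "{}"], rule exI[of _ "{}"]) auto
  then show ?thesis
    unfolding compact_open_topology_def topology_generated_by_topspace by blast
qed

lemma subgroup_homeo_BijGroup: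
  "subgroup {f \<in> Bij (topspace X). homeomorphic_map X X f} (BijGroup (topspace X))"
proof (rule group.subgroupI[OF group_BijGroup])
  let ?S = "topspace X"
  have "homeomorphic_map X X (\<lambda>x\<in>?S. x)"
    by (rule homeomorphic_map_eq[of X X id]) (auto intro: homeomorphic_map_id)
  then show "{f \<in> Bij ?S. homeomorphic_map X X f} \<noteq> {}" using id_Bij by blast
  show "inv\<^bsub>BijGroup ?S\<^esub> f \<in> {f \<in> Bij ?S. homeomorphic_map X X f}"
    if "f \<in> {f \<in> Bij ?S. homeomorphic_map X X f}" for f
  proof -
    from that have f: "f \<in> Bij ?S" "homeomorphic_map X X f" by auto
    obtain g where g: "homeomorphic_maps X X f g" using f homeomorphic_map_maps by blast
    have cg: "continuous_map X X g"
      using g unfolding homeomorphic_maps_def by (elim conjE)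
    have fg: "f (g x) = x" if "x \<in> ?S" for x
      using g that unfolding homeomorphic_maps_def by (elim conjE) (erule bspec)
    have gS: "g x \<in> ?S" if "x \<in> ?S" for x
      by (rule funcset_mem[OF continuous_map_funspace[OF cg] that])
    have inj: "inj_on f ?S" using f(1) by (simp add: Bij_def bij_betw_def)
    have eq: "g x = (\<lambda>x\<in>?S. inv_into ?S f x) x" if x: "x \<in> ?S" for x
    proof -
      have "inv_into ?S f (f (g x)) = g x" by (rule inv_into_f_f[OF inj gS[OF x]])
      then show ?thesis unfolding fg[OF x] restrict_apply'[OF x] by (rule sym)
    qed
    have "homeomorphic_map X X g"
      using g unfolding homeomorphic_maps_map by (elim conjE)
    then have "homeomorphic_map X X (\<lambda>x\<in>?S. inv_into ?S f x)"
      by (rule homeomorphic_map_eq) (rule eq)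
    then show ?thesis using f by (simp add: inv_BijGroup restrict_inv_into_Bij)
  qed
  show "f \<otimes>\<^bsub>BijGroup ?S\<^esub> h \<in> {f \<in> Bij ?S. homeomorphic_map X X f}"
    if "f \<in> {f \<in> Bij ?S. homeomorphic_map X X f}" "h \<in> {f \<in> Bij ?S. homeomorphic_map X X f}" for f h
  proof -
    have "homeomorphic_map X X (f \<circ> h)"
      using that by (blast intro: homeomorphic_map_compose)
    then have "homeomorphic_map X X (compose ?S f h)"
      by (rule homeomorphic_map_eq) (simp add: compose_def)
    then show ?thesis using that by (simp add: BijGroup_def compose_Bij)
  qed
qed (auto simp: BijGroup_def)

lemma group_homeo_group: "group (homeo_group X)"
  unfolding homeo_group_def
  by (rule group.subgroup_imp_group[OF group_BijGroup subgroup_homeo_BijGroup])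


section \<open>The Vietoris topology\<close>

definition Exp_set :: "'a topology \<Rightarrow> 'a set set" where
  "Exp_set K = {A. closedin K A \<and> A \<noteq> {}}"

text \<open>The closed subbase is turned into an open one by taking complements.\<close>

definition Exp :: "'a topology \<Rightarrow> 'a set topology" where
  "Exp K = topology_generated_by
     ({Exp_set K - {A \<in> Exp_set K. A \<subseteq> F} | F. closedin K F} \<union>
      {Exp_set K - {A \<in> Exp_set K. A \<inter> F \<noteq> {}} | F. closedin K F})"

lemma topspace_Exp: "topspace (Exp K) = Exp_set K"
proof -
  have "Exp_set K - {A \<in> Exp_set K. A \<inter> {} \<noteq> {}} \<in>
      {Exp_set K - {A \<in> Exp_set K. A \<inter> F \<noteq> {}} | F. closedin K F}"
    by (rule CollectI, rule exI[of _ "{}"]) auto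
  then have "Exp_set K \<in> {Exp_set K - {A \<in> Exp_set K. A \<inter> F \<noteq> {}} | F. closedin K F}" by simp
  then show ?thesis unfolding Exp_def topology_generated_by_topspace by blast
qed

definition Exp_action :: "('g \<Rightarrow> 'y \<Rightarrow> 'y) \<Rightarrow> 'g \<Rightarrow> 'y set \<Rightarrow> 'y set" where
  "Exp_action act g A = {act g a | a. a \<in> A}"


section \<open>Graphs of homeomorphisms\<close>

definition graph :: "'a topology \<Rightarrow> ('a \<Rightarrow> 'a) \<Rightarrow> ('a \<times> 'a) set" where
  "graph X g = {(x, g x) | x. x \<in> topspace X}"

definition graph_action :: "('a \<Rightarrow> 'a) \<Rightarrow> ('a \<times> 'a) set \<Rightarrow> ('a \<times> 'a) set" where
  "graph_action g F = {(x, g y) | x y. (x, y) \<in> F}"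

definition graph_closure :: "'a topology \<Rightarrow> ('a \<Rightarrow> 'a) set \<Rightarrow> ('a \<times> 'a) set set" where
  "graph_closure X G = Exp (prod_topology X X) closure_of (graph X ` G)"

definition graph_space :: "'a topology \<Rightarrow> ('a \<Rightarrow> 'a) set \<Rightarrow> ('a \<times> 'a) set topology" where
  "graph_space X G = subtopology (Exp (prod_topology X X)) (graph_closure X G)"

end

theory Submission
  imports Defs
begin

text \<open>
  If \<open>G\<close> is extremely amenable, a minimal closed \<open>G\<close>-subset of the compact \<open>G\<close>-space \<open>Exp R\<close>
  contains a fixed point and is therefore a singleton.

  Conversely, suppose that no point of a compact \<open>G\<close>-space \<open>Y\<close> is fixed. By compactness, \<open>Y\<close> is
  covered by finitely many open sets \<open>P\<^sub>j\<close>, each with an element \<open>k\<^sub>j\<close> of \<open>G\<close> and neighbourhoods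
  \<open>N\<^sub>j\<close> of \<open>1\<close> and \<open>N'\<^sub>j\<close> of \<open>k\<^sub>j\<close> such that \<open>N\<^sub>j P\<^sub>j\<close> and \<open>N'\<^sub>j P\<^sub>j\<close> are disjoint. Fix \<open>y\<^sub>0\<close> in \<open>Y\<close> and
  let \<open>C\<^sub>j\<close> be the closure in \<open>R\<close> of the graphs of those \<open>g\<close> with \<open>g\<inverse>y\<^sub>0 \<in> P\<^sub>j\<close>. A minimal closed
  invariant set in the orbit closure of the tuple \<open>(C\<^sub>j)\<close> projects onto minimal sets of \<open>Exp R\<close>,
  so it is a single tuple \<open>(D\<^sub>j)\<close> of invariant sets. For every \<open>h\<close> the sets \<open>h C\<^sub>j\<close> together
  contain all graphs, so the graph of \<open>1\<close> lies in some \<open>D\<^sub>j\<close>; by invariance the graph of \<open>k\<^sub>j\<close> lies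
  in \<open>D\<^sub>j\<close> as well. On graphs the Vietoris topology is at least as fine as the compact-open topology,
  so some \<open>h C\<^sub>j\<close> close to \<open>D\<^sub>j\<close> contains the graphs of some \<open>h g \<in> N\<^sub>j\<close> and \<open>h g' \<in> N'\<^sub>j\<close> with
  \<open>g\<inverse>y\<^sub>0\<close> and \<open>g'\<inverse>y\<^sub>0\<close> in \<open>P\<^sub>j\<close>. Then \<open>h y\<^sub>0 = (h g)(g\<inverse>y\<^sub>0) = (h g')(g'\<inverse>y\<^sub>0)\<close> lies in
  both of the disjoint sets.
\<close>

section \<open>The space of closed subsets\<close>

text \<open>A closed set fails to lie inside \<open>F\<close> exactly when it meets the complement
  of \<open>F\<close>, and fails to meet \<open>F\<close> exactly when it lies inside that
  complement. So the complements of the closed subbase are the usual open hit and miss sets, with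
  the two families exchanged.\<close>

lemma Exp_alt_def:
  "Exp K = topology_generated_by
     ({{A \<in> Exp_set K. A \<subseteq> U} | U. openin K U} \<union> {{A \<in> Exp_set K. A \<inter> U \<noteq> {}} | U. openin K U})"
proof -
  have meets: "Exp_set K - {A \<in> Exp_set K. A \<subseteq> F} = {A \<in> Exp_set K. A \<inter> (topspace K - F) \<noteq> {}}" for F
    by (auto simp: Exp_set_def dest: closedin_subset)
  have inside: "Exp_set K - {A \<in> Exp_set K. A \<inter> F \<noteq> {}} = {A \<in> Exp_set K. A \<subseteq> topspace K - F}" for F
    by (auto simp: Exp_set_def dest: closedin_subset)
  \<comment> \<open>Complementation is a bijection between closed and open sets, so each family can
    be reindexed by open sets; \<open>h\<close> stands for either kind of subbasic set.\<close>
  have compl: "{h (topspace K - F) | F. closedin K F} = {h U | U. openin K U}"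
    for h :: "'a set \<Rightarrow> 'a set set"
  proof -
    have "Collect (openin K) = (-) (topspace K) ` Collect (closedin K)"
    proof (intro equalityI subsetI)
      fix U assume "U \<in> Collect (openin K)"
      then show "U \<in> (-) (topspace K) ` Collect (closedin K)"
        by (intro image_eqI[of _ _ "topspace K - U"]) (auto simp: double_diff openin_subset)
    qed auto
    then have "h ` Collect (openin K) = (\<lambda>F. h (topspace K - F)) ` Collect (closedin K)"
      by (simp add: image_image)
    then show ?thesis by (simp add: image_Collect)
  qed
  show ?thesis
    unfolding Exp_def meets inside compl[of "\<lambda>U. {A \<in> Exp_set K. A \<subseteq> U}"]
      compl[of "\<lambda>U. {A \<in> Exp_set K. A \<inter> U \<noteq> {}}"]
    by (subst Un_commute) (rule refl)
qed

lemma openin_Exp_subset: "openin K U \<Longrightarrow> openin (Exp K) {A \<in> Exp_set K. A \<subseteq> U}"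
  unfolding Exp_alt_def by (rule topology_generated_by_Basis) blast

lemma openin_Exp_meets: "openin K U \<Longrightarrow> openin (Exp K) {A \<in> Exp_set K. A \<inter> U \<noteq> {}}"
  unfolding Exp_alt_def by (rule topology_generated_by_Basis) blast

lemma continuous_map_into_Exp:
  assumes "\<And>x. x \<in> topspace Z \<Longrightarrow> f x \<in> Exp_set K"
    and "\<And>U. openin K U \<Longrightarrow> openin Z {x \<in> topspace Z. f x \<subseteq> U}"
    and "\<And>U. openin K U \<Longrightarrow> openin Z {x \<in> topspace Z. f x \<inter> U \<noteq> {}}"
  shows "continuous_map Z (Exp K) f"
  unfolding Exp_alt_def
proof (rule continuous_on_generated_topo)
  fix S
  assume "S \<in> {{A \<in> Exp_set K. A \<subseteq> U} | U. openin K U} \<union> {{A \<in> Exp_set K. A \<inter> U \<noteq> {}} | U. openin K U}"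
  then consider U where "openin K U" "S = {A \<in> Exp_set K. A \<subseteq> U}"
    | U where "openin K U" "S = {A \<in> Exp_set K. A \<inter> U \<noteq> {}}" by blast
  then show "openin Z (f -` S \<inter> topspace Z)"
  proof cases
    case 1
    then have "f -` S \<inter> topspace Z = {x \<in> topspace Z. f x \<subseteq> U}" using assms(1) by auto
    then show ?thesis using assms(2) 1 by simp
  next
    case 2
    then have "f -` S \<inter> topspace Z = {x \<in> topspace Z. f x \<inter> U \<noteq> {}}" using assms(1) by auto
    then show ?thesis using assms(3) 2 by simp
  qed
next
  have "f ` topspace Z \<subseteq> Exp_set K" using assms(1) by auto
  also have "\<dots> = topspace (Exp K)" by (simp add: topspace_Exp)
  finally show "f ` topspace Z \<subseteq> \<Union> ({{A \<in> Exp_set K. A \<subseteq> U} | U. openin K U} \<union> {{A \<in> Exp_set K. A \<inter> U \<noteq> {}} | U. openin K U})"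
    unfolding Exp_alt_def topology_generated_by_topspace .
qed

section \<open>Compactness and separation of the hyperspace\<close>

text \<open>\<open>Alexander_subbase\<close> describes a topology by arbitrary unions of finite
  intersections of subbasic sets; this is the bridge to \<open>topology_generated_by\<close>, in
  which \<open>Exp\<close> is defined.\<close>

lemma topology_generated_by_subbase:
  "topology (arbitrary union_of (finite intersection_of (\<lambda>x. x \<in> \<B>) relative_to \<Union>\<B>))
     = topology_generated_by \<B>" (is "?L = _")
proof (rule topology_eq[THEN iffD2], intro allI iffI)
  have L: "openin ?L = arbitrary union_of (finite intersection_of (\<lambda>x. x \<in> \<B>) relative_to \<Union>\<B>)"
    by (rule topology_inverse'[OF istopology_subbase])
  fix S
  show "openin (topology_generated_by \<B>) S" if "openin ?L S"
  proof -
    have "openin (topology_generated_by \<B>) V"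
      if V: "(finite intersection_of (\<lambda>x. x \<in> \<B>) relative_to \<Union>\<B>) V" for V
    proof -
      obtain \<F> where "finite \<F>" "\<F> \<subseteq> \<B>" "V = \<Union>\<B> \<inter> \<Inter>\<F>"
        using V by (auto simp: relative_to_def intersection_of_def)
      moreover have "openin (topology_generated_by \<B>) (\<Union>\<B> \<inter> \<Inter>\<F>)"
        using \<open>finite \<F>\<close> \<open>\<F> \<subseteq> \<B>\<close>
      proof (induction \<F>)
        case empty
        show ?case using openin_topspace[of "topology_generated_by \<B>"] by simp
      next
        case (insert S \<F>)
        have "\<Union>\<B> \<inter> \<Inter>(insert S \<F>) = S \<inter> (\<Union>\<B> \<inter> \<Inter>\<F>)" by auto
        then show ?case using insert by (auto intro: topology_generated_by_Basis)
      qed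
      ultimately show ?thesis by simp
    qed
    moreover have "(arbitrary union_of (finite intersection_of (\<lambda>x. x \<in> \<B>) relative_to \<Union>\<B>)) S"
      using that by (simp only: L)
    ultimately show ?thesis
      by (simp add: union_of_def arbitrary_def) (metis openin_Union mem_Collect_eq subsetD)
  qed
  show "openin ?L S" if "openin (topology_generated_by \<B>) S"
  proof (rule generate_topology_on_coarsest[of "openin ?L" \<B>])
    show "istopology (openin ?L)" by simp
    show "openin ?L s" if "s \<in> \<B>" for s
      unfolding L
      by (intro arbitrary_union_of_inc relative_to_subset_inc finite_intersection_of_inc)
        (use that in auto)
    show "generate_topology_on \<B> S" using that by (rule openin_topology_generated_by)
  qed
qed

text \<open>By Alexander's subbase theorem only covers by hit and miss sets need finite subcovers.
  If the open sets \<open>U\<close> with \<open>meets U\<close> in the cover already cover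
  \<open>K\<close>, finitely many of them do, and every non-empty closed set hits one. Otherwise
  what they leave over is itself a point of \<open>Exp K\<close>, which forces a set
  \<open>inside U\<close> into the cover; then finitely many hit sets take care of the compact set
  \<open>K - U\<close>.\<close>

lemma compact_space_Exp:
  assumes K: "compact_space K"
  shows "compact_space (Exp K)"
proof (rule Alexander_subbase)
  let ?B = "{{A \<in> Exp_set K. A \<subseteq> U} | U. openin K U} \<union> {{A \<in> Exp_set K. A \<inter> U \<noteq> {}} | U. openin K U}"
  show "topology (arbitrary union_of (finite intersection_of (\<lambda>x. x \<in> ?B) relative_to \<Union>?B)) = Exp K"
    unfolding topology_generated_by_subbase by (simp add: Exp_alt_def)
  fix C assume C: "C \<subseteq> ?B" "\<Union>C = topspace (Exp K)"
  define meets where "meets U = {A \<in> Exp_set K. A \<inter> U \<noteq> {}}" for U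
  define inside where "inside U = {A \<in> Exp_set K. A \<subseteq> U}" for U
  define \<U> where "\<U> = {U. openin K U \<and> meets U \<in> C}"
  have fin: "\<exists>\<F>. finite \<F> \<and> \<F> \<subseteq> \<U> \<and> D \<subseteq> \<Union>\<F>" if "closedin K D" "D \<subseteq> \<Union>\<U>" for D
  proof -
    have "\<forall>U\<in>\<U>. openin K U" by (simp add: \<U>_def)
    moreover have "compactin K D" using closedin_compact_space[OF K that(1)] .
    ultimately show ?thesis using that(2) by (simp add: compactin_def)
  qed
  show "\<exists>C'. finite C' \<and> C' \<subseteq> C \<and> \<Union>C' = topspace (Exp K)"
  proof (cases "topspace K \<subseteq> \<Union>\<U>")
    case True
    then obtain \<F> where \<F>: "finite \<F>" "\<F> \<subseteq> \<U>" "topspace K \<subseteq> \<Union>\<F>"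
      using fin[OF closedin_topspace] by blast
    have sub: "meets ` \<F> \<subseteq> C" using \<F> by (auto simp: \<U>_def)
    moreover have "topspace (Exp K) \<subseteq> \<Union>(meets ` \<F>)"
      unfolding topspace_Exp
    proof
      fix A assume A: "A \<in> Exp_set K"
      then obtain a where "a \<in> A" "a \<in> topspace K" by (auto simp: Exp_set_def dest: closedin_subset)
      then obtain U where "U \<in> \<F>" "a \<in> U" using \<F>(3) by blast
      with A \<open>a \<in> A\<close> show "A \<in> \<Union>(meets ` \<F>)" by (auto simp: meets_def)
    qed
    ultimately show ?thesis
      using \<F>(1) C(2) Union_mono[OF sub] by (intro exI[of _ "meets ` \<F>"] conjI equalityI) simp_all
  next
    case False
    \<comment> \<open>\<open>F\<close> is a non-empty closed set that belongs to no hit set of the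
      cover, so a member of the cover containing it must have the form
      \<open>inside U\<close>.\<close>
    define F where "F = topspace K - \<Union>\<U>"
    have "openin K (\<Union>\<U>)" by (rule openin_Union) (simp add: \<U>_def)
    then have F: "F \<in> Exp_set K" using False by (auto simp: F_def Exp_set_def)
    then obtain S where S: "S \<in> C" "F \<in> S" using C(2) by (auto simp: topspace_Exp)
    have "F \<notin> meets U" if "U \<in> \<U>" for U using that by (auto simp: F_def meets_def)
    then have "\<not> (openin K U \<and> S = meets U)" for U using S by (auto simp: \<U>_def)
    moreover have "(\<exists>U. S = inside U \<and> openin K U) \<or> (\<exists>U. S = meets U \<and> openin K U)"
      using subsetD[OF C(1) S(1)] by (simp only: Un_iff mem_Collect_eq meets_def inside_def)
    ultimately obtain U where "openin K U" "S = inside U" by metis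
    then have U: "openin K U" "S = {A \<in> Exp_set K. A \<subseteq> U}" by (simp_all only: inside_def)
    have "topspace K - U \<subseteq> \<Union>\<U>" using S(2) U by (auto simp: F_def)
    moreover have "closedin K (topspace K - U)" using U(1) by (simp add: closedin_diff)
    ultimately obtain \<F> where \<F>: "finite \<F>" "\<F> \<subseteq> \<U>" "topspace K - U \<subseteq> \<Union>\<F>"
      using fin[of "topspace K - U"] by blast
    have sub: "insert S (meets ` \<F>) \<subseteq> C" using \<F> S by (auto simp: \<U>_def)
    moreover have "topspace (Exp K) \<subseteq> \<Union>(insert S (meets ` \<F>))"
      unfolding topspace_Exp
    proof
      fix A assume A: "A \<in> Exp_set K"
      show "A \<in> \<Union>(insert S (meets ` \<F>))"
      proof (cases "A \<subseteq> U")
        case False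
        then obtain a where "a \<in> A" "a \<in> topspace K - U"
          using A by (auto simp: Exp_set_def dest: closedin_subset)
        then obtain V where "V \<in> \<F>" "a \<in> V" using \<F>(3) by blast
        with A \<open>a \<in> A\<close> show ?thesis by (auto simp: meets_def)
      qed (use A U in auto)
    qed
    ultimately show ?thesis
      using \<F>(1) C(2) Union_mono[OF sub] by (intro exI[of _ "insert S (meets ` \<F>)"] conjI equalityI) simp_all
  qed
qed

text \<open>If \<open>a\<close> lies in \<open>A\<close> but not in \<open>B\<close>, separate
  \<open>a\<close> from the compact set \<open>B\<close> by disjoint open \<open>U\<close> and
  \<open>V\<close>: no set can both meet \<open>U\<close> and lie inside \<open>V\<close>.\<close>

lemma Hausdorff_space_Exp:
  assumes "compact_space K" "Hausdorff_space K"
  shows "Hausdorff_space (Exp K)"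
  unfolding Hausdorff_space_def
proof (intro allI impI)
  have sep: "\<exists>U V. openin (Exp K) U \<and> openin (Exp K) V \<and> A \<in> U \<and> B \<in> V \<and> disjnt U V"
    if A: "A \<in> Exp_set K" and B: "B \<in> Exp_set K" and ne: "\<not> A \<subseteq> B" for A B
  proof -
    obtain a where a: "a \<in> A" "a \<notin> B" using ne by blast
    then have aK: "a \<in> topspace K" using A by (auto simp: Exp_set_def dest: closedin_subset)
    have "compactin K {a}" "compactin K B" "disjnt {a} B"
      using a aK B assms(1) by (auto simp: Exp_set_def closedin_compact_space)
    then obtain U V where UV: "openin K U" "openin K V" "{a} \<subseteq> U" "B \<subseteq> V" "disjnt U V"
      using assms(2) unfolding Hausdorff_space_compact_sets by meson
    then have "disjnt {A \<in> Exp_set K. A \<inter> U \<noteq> {}} {A \<in> Exp_set K. A \<subseteq> V}"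
      by (auto simp: disjnt_def)
    with UV A B a show ?thesis
      by (intro exI[of _ "{A \<in> Exp_set K. A \<inter> U \<noteq> {}}"] exI[of _ "{A \<in> Exp_set K. A \<subseteq> V}"])
        (auto simp: openin_Exp_meets openin_Exp_subset)
  qed
  fix A B assume "A \<in> topspace (Exp K) \<and> B \<in> topspace (Exp K) \<and> A \<noteq> B"
  then have AB: "A \<in> Exp_set K" "B \<in> Exp_set K" "A \<noteq> B" by (auto simp: topspace_Exp)
  then consider "\<not> A \<subseteq> B" | "\<not> B \<subseteq> A" by blast
  then show "\<exists>U V. openin (Exp K) U \<and> openin (Exp K) V \<and> A \<in> U \<and> B \<in> V \<and> disjnt U V"
  proof cases
    case 1 then show ?thesis using sep AB by blast
  next
    case 2 then show ?thesis using sep[of B A] AB by (meson disjnt_sym)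
  qed
qed


section \<open>Compact G-spaces\<close>

lemma Exp_action_eq_image: "Exp_action act g A = act g ` A"
  by (auto simp: Exp_action_def)

section \<open>Existence of minimal invariant sets\<close>

text \<open>Zorn's lemma: the intersection of a chain of non-empty closed invariant sets is closed
  and invariant, and compactness keeps it non-empty.\<close>

lemma ex_minimal_closed_G_subset:
  assumes Y: "compact_space Y" and Z: "closedin Y Z" "Z \<noteq> {}" "\<And>g. g \<in> G \<Longrightarrow> act g ` Z \<subseteq> Z"
  shows "\<exists>M\<subseteq>Z. minimal_closed_G_subset G Y act M"
proof -
  let ?inv = "\<lambda>N. closedin Y N \<and> N \<noteq> {} \<and> (\<forall>g\<in>G. act g ` N \<subseteq> N)"
  \<comment> \<open>Passing to complements turns the search for a smallest set into one for a
    largest, so that Zorn's lemma for unions of chains applies.\<close>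
  define \<C> where "\<C> = {topspace Y - N | N. ?inv N \<and> N \<subseteq> Z}"
  have \<C>: "U \<in> \<C> \<longleftrightarrow> U \<subseteq> topspace Y \<and> ?inv (topspace Y - U) \<and> topspace Y - U \<subseteq> Z" for U
  proof
    assume "U \<in> \<C>"
    then obtain N where N: "U = topspace Y - N" "?inv N" "N \<subseteq> Z" unfolding \<C>_def by blast
    then have "topspace Y - U = N" by (simp add: double_diff closedin_subset)
    with N show "U \<subseteq> topspace Y \<and> ?inv (topspace Y - U) \<and> topspace Y - U \<subseteq> Z" by auto
  next
    assume U: "U \<subseteq> topspace Y \<and> ?inv (topspace Y - U) \<and> topspace Y - U \<subseteq> Z"
    then have "U = topspace Y - (topspace Y - U)" by (simp add: double_diff)
    with U show "U \<in> \<C>" unfolding \<C>_def by blast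
  qed
  have "\<exists>M\<in>\<C>. \<forall>X\<in>\<C>. M \<subseteq> X \<longrightarrow> X = M"
  proof (rule subset_Zorn_nonempty)
    have "topspace Y - Z \<in> \<C>"
      unfolding \<C>_def by (intro CollectI exI[of _ Z]) (use Z in auto)
    then show "\<C> \<noteq> {}" by auto
    fix \<D> assume ne: "\<D> \<noteq> {}" and ch: "subset.chain \<C> \<D>"
    have D: "U \<in> \<C>" if "U \<in> \<D>" for U using ch that by (auto simp: subset.chain_def)
    let ?N = "\<Inter>U\<in>\<D>. topspace Y - U"
    have eq: "topspace Y - \<Union>\<D> = ?N" using ne by auto
    have "?N \<noteq> {}"
    proof -
      \<comment> \<open>A finite non-empty subchain contains its own union, so the intersection of
        the corresponding closed sets is one of them and hence non-empty.\<close>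
      have fip: "\<Inter>\<F> \<noteq> {}" if \<F>: "finite \<F>" "\<F> \<subseteq> (-) (topspace Y) ` \<D>" for \<F>
      proof (cases "\<F> = {}")
        case False
        obtain \<E> where \<E>: "finite \<E>" "\<E> \<subseteq> \<D>" "\<F> = (-) (topspace Y) ` \<E>"
          using \<F> by (meson finite_subset_image)
        have "\<E> \<noteq> {}" using False \<E> by auto
        have "\<Union>\<E> \<in> \<E>"
        proof (rule Union_in_chain)
          show "subset.chain \<C> \<E>" using ch \<E>(2) unfolding subset.chain_def by blast
        qed (use \<E> \<open>\<E> \<noteq> {}\<close> in auto)
        then have "topspace Y - \<Union>\<E> \<noteq> {}" using \<E>(2) D \<C> by blast
        moreover have "topspace Y - \<Union>\<E> = \<Inter>\<F>" using \<E>(3) \<open>\<E> \<noteq> {}\<close> by auto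
        ultimately show ?thesis by simp
      qed simp
      have "\<forall>C\<in>(-) (topspace Y) ` \<D>. closedin Y C" using D \<C> by blast
      then show ?thesis
        using Y[unfolded compact_space_fip, THEN spec, THEN mp, OF conjI] fip by metis
    qed
    moreover have "closedin Y ?N" using ne D \<C> by (intro closedin_Inter) auto
    moreover have "act g ` ?N \<subseteq> ?N" if g: "g \<in> G" for g
    proof -
      have "act g ` ?N \<subseteq> topspace Y - U" if "U \<in> \<D>" for U
        using D[OF that] g that unfolding \<C> by blast
      then show ?thesis by blast
    qed
    moreover have "?N \<subseteq> Z"
    proof -
      obtain U where "U \<in> \<D>" using ne by blast
      then show ?thesis using D[unfolded \<C>, of U] by blast
    qed
    moreover have "\<Union>\<D> \<subseteq> topspace Y" using D[unfolded \<C>] by blast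
    ultimately show "\<Union>\<D> \<in> \<C>" unfolding \<C> eq by simp
  qed
  then obtain U where U: "U \<in> \<C>" and max: "\<And>V. V \<in> \<C> \<Longrightarrow> U \<subseteq> V \<Longrightarrow> V = U" by blast
  have "minimal_closed_G_subset G Y act (topspace Y - U)"
    unfolding minimal_closed_G_subset_def
  proof (intro conjI allI impI)
    fix N assume N: "closedin Y N \<and> N \<noteq> {} \<and> (\<forall>g\<in>G. act g ` N \<subseteq> N) \<and> N \<subseteq> topspace Y - U"
    then have "N \<subseteq> Z" using U[unfolded \<C>] by blast
    then have "topspace Y - N \<in> \<C>" unfolding \<C>_def using N by blast
    moreover have "U \<subseteq> topspace Y - N" using N U[unfolded \<C>] by blast
    ultimately have "topspace Y - N = U" by (rule max)
    moreover have "topspace Y - (topspace Y - N) = N" using N by (simp add: double_diff closedin_subset)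
    ultimately show "N = topspace Y - U" by simp
  qed (use U[unfolded \<C>] in auto)
  moreover have "topspace Y - U \<subseteq> Z" using U[unfolded \<C>] by (elim conjE)
  ultimately show ?thesis by blast
qed

text \<open>The locale predicate also serves as the conclusion of lemmas: it passes to closed
  invariant subspaces, to \<open>Exp\<close>, and to products with a compact Hausdorff space on
  which the group acts trivially. Iterating these steps builds \<open>Exp R\<close> from
  \<open>X\<close>.\<close>

locale compact_G_space =
  fixes \<Gamma> :: "('g, 'm) monoid_scheme" and T :: "'g topology" and Y :: "'y topology"
    and act :: "'g \<Rightarrow> 'y \<Rightarrow> 'y"
  assumes group_\<Gamma>: "group \<Gamma>" and topspace_T: "topspace T = carrier \<Gamma>"
    and compact_Y: "compact_space Y" and Hausdorff_Y: "Hausdorff_space Y"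
    and G_space: "G_space \<Gamma> T Y act"
begin

abbreviation "G \<equiv> carrier \<Gamma>"

lemma continuous_action: "continuous_map (prod_topology T Y) Y (\<lambda>(g, y). act g y)"
  using G_space by (simp add: G_space_def)

lemma act_mult: "g \<in> G \<Longrightarrow> h \<in> G \<Longrightarrow> y \<in> topspace Y \<Longrightarrow> act g (act h y) = act (g \<otimes>\<^bsub>\<Gamma>\<^esub> h) y"
  using G_space by (simp add: G_space_def)

lemma act_one: "y \<in> topspace Y \<Longrightarrow> act \<one>\<^bsub>\<Gamma>\<^esub> y = y"
  using G_space by (simp add: G_space_def)

lemma act_in: "g \<in> G \<Longrightarrow> y \<in> topspace Y \<Longrightarrow> act g y \<in> topspace Y"
  using funcset_mem[OF continuous_map_funspace[OF continuous_action], of "(g, y)"]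
  by (simp add: topspace_T)

lemma act_inv: "g \<in> G \<Longrightarrow> y \<in> topspace Y \<Longrightarrow> act g (act (inv\<^bsub>\<Gamma>\<^esub> g) y) = y"
  using group_\<Gamma> by (simp add: act_mult act_one group.inv_closed group.r_inv)

lemma continuous_map_act:
  assumes "g \<in> G"
  shows "continuous_map Y Y (act g)"
proof -
  have "continuous_map Y (prod_topology T Y) (\<lambda>y. (g, y))"
    using assms topspace_T by (intro continuous_map_pairedI) auto
  from continuous_map_compose[OF this continuous_action] show ?thesis by (simp add: o_def)
qed

lemma neighbourhoods_of_action:
  assumes "openin Y U" "g \<in> G" "y \<in> topspace Y" "act g y \<in> U"
  shows "\<exists>N P. openin T N \<and> openin Y P \<and> g \<in> N \<and> y \<in> P \<and> (\<forall>h\<in>N. \<forall>z\<in>P. act h z \<in> U)"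
proof -
  define W where "W = {p \<in> topspace (prod_topology T Y). (\<lambda>(g, y). act g y) p \<in> U}"
  have "openin (prod_topology T Y) W"
    unfolding W_def by (rule openin_continuous_map_preimage[OF continuous_action assms(1)])
  moreover have "(g, y) \<in> W"
    using assms topspace_T by (simp add: W_def)
  ultimately have "\<exists>N P. openin T N \<and> openin Y P \<and> g \<in> N \<and> y \<in> P \<and> N \<times> P \<subseteq> W"
    by (simp add: openin_prod_topology_alt)
  then obtain N P where "openin T N" "openin Y P" "g \<in> N" "y \<in> P" "N \<times> P \<subseteq> W"
    by blast
  then show ?thesis by (intro exI[of _ N] exI[of _ P]) (auto simp: W_def)
qed

lemma closure_invariant:
  assumes "g \<in> G" "act g ` A \<subseteq> A"
  shows "act g ` (Y closure_of A) \<subseteq> Y closure_of A"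
  using continuous_map_image_closure_subset[OF continuous_map_act[OF assms(1)], of A]
    closure_of_mono[OF assms(2), of Y] by blast

section \<open>Constructions of compact G-spaces\<close>

lemma subspace:
  assumes S: "closedin Y S" "\<And>g. g \<in> G \<Longrightarrow> act g ` S \<subseteq> S"
  shows "compact_G_space \<Gamma> T (subtopology Y S) act"
proof (rule compact_G_space.intro)
  show "compact_space (subtopology Y S)"
    using compact_Y S(1) by (simp add: closedin_compact_space compact_space_subtopology)
  show "Hausdorff_space (subtopology Y S)" by (rule Hausdorff_space_subtopology[OF Hausdorff_Y])
  have "continuous_map (subtopology (prod_topology T Y) (G \<times> S)) Y (\<lambda>(g, y). act g y)"
    by (rule continuous_map_from_subtopology[OF continuous_action])
  \<comment> \<open>As \<open>G\<close> is the whole space of \<open>T\<close>, cutting the product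
    down to \<open>G \<times> S\<close> only restricts the second factor.\<close>
  moreover have "subtopology (prod_topology T Y) (G \<times> S) = prod_topology T (subtopology Y S)"
    by (metis prod_topology_subtopology(2) subtopology_topspace subtopology_Times topspace_T)
  ultimately have "continuous_map (prod_topology T (subtopology Y S)) (subtopology Y S) (\<lambda>(g, y). act g y)"
    using S(2) by (auto simp: continuous_map_in_subtopology topspace_T)
  then show "G_space \<Gamma> T (subtopology Y S) act"
    unfolding G_space_def by (auto simp: act_mult act_one)
qed (rule group_\<Gamma> topspace_T)+

text \<open>Joint continuity is tested on hit and miss sets. For sets lying inside \<open>U\<close>,
  compactness of \<open>A\<close> and the tube lemma give a neighbourhood of
  \<open>{g} \<times> A\<close>; for sets meeting \<open>U\<close>, continuity of the action at one
  point \<open>(g, a)\<close> suffices.\<close>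

lemma Exp_space: "compact_G_space \<Gamma> T (Exp Y) (Exp_action act)"
proof (rule compact_G_space.intro)
  show "compact_space (Exp Y)" by (rule compact_space_Exp[OF compact_Y])
  show "Hausdorff_space (Exp Y)" by (rule Hausdorff_space_Exp[OF compact_Y Hausdorff_Y])
  have sub: "A \<subseteq> topspace Y" if "A \<in> Exp_set Y" for A
    using that by (auto simp: Exp_set_def dest: closedin_subset)
  have cpt: "compactin Y A" if "A \<in> Exp_set Y" for A
    using that by (auto simp: Exp_set_def intro: closedin_compact_space compact_Y)
  let ?ZT = "prod_topology T (Exp Y)"
  have "continuous_map ?ZT (Exp Y) (\<lambda>(g, A). act g ` A)"
  proof (rule continuous_map_into_Exp)
    fix p assume "p \<in> topspace ?ZT"
    then obtain g A where p: "p = (g, A)" "g \<in> G" "A \<in> Exp_set Y"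
      by (auto simp: topspace_Exp topspace_T)
    \<comment> \<open>Closedness of the translate comes from compactness: compact sets are closed in
      the Hausdorff space \<open>Y\<close>.\<close>
    have "compactin Y (act g ` A)"
      using image_compactin[OF cpt continuous_map_act] p by blast
    then show "(\<lambda>(g, A). act g ` A) p \<in> Exp_set Y"
      using p by (auto simp: Exp_set_def compactin_imp_closedin Hausdorff_Y)
  next
    fix U assume U: "openin Y U"
    show "openin ?ZT {p \<in> topspace ?ZT. (\<lambda>(g, A). act g ` A) p \<subseteq> U}"
      unfolding openin_prod_topology_alt
    proof (intro allI impI)
      fix g A assume "(g, A) \<in> {p \<in> topspace ?ZT. (\<lambda>(g, A). act g ` A) p \<subseteq> U}"
      then have g: "g \<in> G" and A: "A \<in> Exp_set Y" and gA: "act g ` A \<subseteq> U"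
        by (auto simp: topspace_Exp topspace_T)
      define W where "W = {p \<in> topspace (prod_topology T Y). (\<lambda>(g, y). act g y) p \<in> U}"
      have "openin (prod_topology T Y) W"
        unfolding W_def by (rule openin_continuous_map_preimage[OF continuous_action U])
      moreover have "{g} \<times> A \<subseteq> W" using g gA sub[OF A] by (auto simp: W_def topspace_T)
      ultimately obtain N P where NP: "openin T N" "openin Y P" "g \<in> N" "A \<subseteq> P" "N \<times> P \<subseteq> W"
        using tube_lemma_right[of T Y W A g] cpt[OF A] g topspace_T by auto
      then have "act h y \<in> U" if "h \<in> N" "y \<in> P" for h y
        using subsetD[OF NP(5), of "(h, y)"] that by (simp add: W_def)
      then have "N \<times> {A \<in> Exp_set Y. A \<subseteq> P} \<subseteq> {p \<in> topspace ?ZT. (\<lambda>(g, A). act g ` A) p \<subseteq> U}"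
        using openin_subset[OF NP(1)] by (fastforce simp: topspace_Exp)
      with NP show "\<exists>N Q. openin T N \<and> openin (Exp Y) Q \<and> g \<in> N \<and> A \<in> Q \<and>
          N \<times> Q \<subseteq> {p \<in> topspace ?ZT. (\<lambda>(g, A). act g ` A) p \<subseteq> U}"
        using A by (intro exI[of _ N] exI[of _ "{A \<in> Exp_set Y. A \<subseteq> P}"])
          (auto simp: openin_Exp_subset)
    qed
    show "openin ?ZT {p \<in> topspace ?ZT. (\<lambda>(g, A). act g ` A) p \<inter> U \<noteq> {}}"
      unfolding openin_prod_topology_alt
    proof (intro allI impI)
      fix g A assume "(g, A) \<in> {p \<in> topspace ?ZT. (\<lambda>(g, A). act g ` A) p \<inter> U \<noteq> {}}"
      then obtain a where g: "g \<in> G" and A: "A \<in> Exp_set Y" and a: "a \<in> A" "act g a \<in> U"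
        by (auto simp: topspace_Exp topspace_T)
      have "a \<in> topspace Y" using sub[OF A] a(1) by blast
      then obtain N P where NP: "openin T N" "openin Y P" "g \<in> N" "a \<in> P" "\<forall>h\<in>N. \<forall>z\<in>P. act h z \<in> U"
        using neighbourhoods_of_action[OF U g _ a(2)] by blast
      have "N \<times> {A \<in> Exp_set Y. A \<inter> P \<noteq> {}} \<subseteq> {p \<in> topspace ?ZT. (\<lambda>(g, A). act g ` A) p \<inter> U \<noteq> {}}"
      proof
        fix p assume "p \<in> N \<times> {A \<in> Exp_set Y. A \<inter> P \<noteq> {}}"
        then obtain h B b where p: "p = (h, B)" "h \<in> N" "B \<in> Exp_set Y" "b \<in> B" "b \<in> P" by auto
        then have "act h b \<in> act h ` B \<inter> U" "h \<in> topspace T"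
          using NP(5) openin_subset[OF NP(1)] by auto
        with p show "p \<in> {p \<in> topspace ?ZT. (\<lambda>(g, A). act g ` A) p \<inter> U \<noteq> {}}"
          by (auto simp: topspace_Exp)
      qed
      then show "\<exists>N Q. openin T N \<and> openin (Exp Y) Q \<and> g \<in> N \<and> A \<in> Q \<and>
          N \<times> Q \<subseteq> {p \<in> topspace ?ZT. (\<lambda>(g, A). act g ` A) p \<inter> U \<noteq> {}}"
        using A a NP by (intro exI[of _ N] exI[of _ "{A \<in> Exp_set Y. A \<inter> P \<noteq> {}}"])
          (auto simp: openin_Exp_meets)
    qed
  qed
  then show "G_space \<Gamma> T (Exp Y) (Exp_action act)"
    unfolding G_space_def Exp_action_eq_image topspace_Exp
  proof (intro conjI ballI)
    show "act g ` act h ` A = act (g \<otimes>\<^bsub>\<Gamma>\<^esub> h) ` A" if "g \<in> G" "h \<in> G" "A \<in> Exp_set Y" for g h A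
      unfolding image_image using sub[OF that(3)] that by (intro image_cong) (auto simp: act_mult)
    show "act \<one>\<^bsub>\<Gamma>\<^esub> ` A = A" if "A \<in> Exp_set Y" for A
    proof -
      have "act \<one>\<^bsub>\<Gamma>\<^esub> ` A = id ` A" using sub[OF that] by (intro image_cong) (auto simp: act_one)
      then show ?thesis by simp
    qed
  qed
qed (rule group_\<Gamma> topspace_T)+

text \<open>Taken with \<open>K = Y = X\<close>, this is the action on the square that moves only
  the second coordinate; it induces \<open>graph_action\<close> on closed sets.\<close>

lemma product_with_trivial_action:
  assumes "compact_space K" "Hausdorff_space K"
  shows "compact_G_space \<Gamma> T (prod_topology K Y) (\<lambda>g (x, y). (x, act g y))"
proof (rule compact_G_space.intro)
  have "continuous_map (prod_topology T (prod_topology K Y)) (prod_topology T Y)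
      (\<lambda>p. (fst p, snd (snd p)))"
    by (intro continuous_map_pairedI continuous_map_fst
        continuous_map_compose[OF continuous_map_snd continuous_map_snd, unfolded o_def])
  from continuous_map_compose[OF this continuous_action]
  have "continuous_map (prod_topology T (prod_topology K Y)) Y (\<lambda>p. act (fst p) (snd (snd p)))"
    by (simp add: o_def)
  then have "continuous_map (prod_topology T (prod_topology K Y)) (prod_topology K Y)
      (\<lambda>p. (fst (snd p), act (fst p) (snd (snd p))))"
    by (intro continuous_map_pairedI
        continuous_map_compose[OF continuous_map_snd continuous_map_fst, unfolded o_def])
  then show "G_space \<Gamma> T (prod_topology K Y) (\<lambda>g (x, y). (x, act g y))"
    unfolding G_space_def by (auto simp: act_mult act_one case_prod_unfold)
  show "compact_space (prod_topology K Y)"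
    unfolding compact_space_prod_topology using assms compact_Y by blast
  show "Hausdorff_space (prod_topology K Y)"
    unfolding Hausdorff_space_prod_topology using assms Hausdorff_Y by blast
qed (rule group_\<Gamma> topspace_T)+

section \<open>Minimal sets and fixed points\<close>

text \<open>Choose a minimal set \<open>M\<close> in the orbit closure of the tuple \<open>c\<close>
  under the diagonal action. Each projection of \<open>M\<close> is minimal in \<open>Y\<close>,
  hence a singleton, and the point of an invariant singleton is fixed. The gain is that one net of
  group elements moves all \<open>c i\<close> to fixed points simultaneously.\<close>

lemma common_limit_of_fixed_points:
  fixes c :: "'i \<Rightarrow> 'y"
  assumes min: "\<And>M. minimal_closed_G_subset G Y act M \<Longrightarrow> is_singleton M"
    and c: "\<And>i. i \<in> I \<Longrightarrow> c i \<in> topspace Y"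
  shows "\<exists>d \<in> product_topology (\<lambda>_. Y) I closure_of {\<lambda>i\<in>I. act g (c i) | g. g \<in> G}.
           \<forall>i\<in>I. \<forall>g\<in>G. act g (d i) = d i"
proof -
  let ?P = "product_topology (\<lambda>_. Y) I"
  define actP where "actP g x = (\<lambda>i\<in>I. act g (x i))" for g and x :: "'i \<Rightarrow> 'y"
  define orb where "orb = {actP g c | g. g \<in> G}"
  define Z where "Z = ?P closure_of orb"
  have cP: "continuous_map ?P ?P (actP g)" if "g \<in> G" for g
    unfolding continuous_map_componentwise
  proof (intro conjI ballI)
    show "actP g ` topspace ?P \<subseteq> extensional I" by (auto simp: actP_def)
    fix k assume k: "k \<in> I"
    have "continuous_map ?P Y (act g \<circ> (\<lambda>x. x k))"
      by (rule continuous_map_compose[OF continuous_map_product_projection[OF k] continuous_map_act[OF that]])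
    then show "continuous_map ?P Y (\<lambda>x. actP g x k)" using k by (simp add: actP_def o_def)
  qed
  have "actP g (actP h c) = actP (g \<otimes>\<^bsub>\<Gamma>\<^esub> h) c" if "g \<in> G" "h \<in> G" for g h
    using that c by (auto simp: actP_def act_mult intro!: restrict_ext)
  then have orb_inv: "actP g ` orb \<subseteq> orb" if "g \<in> G" for g
    using that group_\<Gamma> by (auto simp: orb_def intro!: monoid.m_closed[OF group.axioms(1)])
  have Z_inv: "actP g ` Z \<subseteq> Z" if "g \<in> G" for g
    using continuous_map_image_closure_subset[OF cP[OF that], of orb]
      closure_of_mono[OF orb_inv[OF that], of ?P] unfolding Z_def by blast
  have compP: "compact_space ?P" using compact_Y by (simp add: compact_space_product_topology)
  have "orb \<subseteq> topspace ?P" using c act_in by (auto simp: orb_def actP_def)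
  then have "orb \<subseteq> Z" unfolding Z_def by (rule closure_of_subset)
  moreover have "\<one>\<^bsub>\<Gamma>\<^esub> \<in> G" using group_\<Gamma> by (simp add: group.is_monoid)
  ultimately have "Z \<noteq> {}" by (auto simp: orb_def)
  moreover have "closedin ?P Z" by (simp add: Z_def)
  ultimately obtain M where M: "M \<subseteq> Z" "minimal_closed_G_subset G ?P actP M"
    using ex_minimal_closed_G_subset[OF compP, of Z G actP] Z_inv by blast
  have Mc: "closedin ?P M" "M \<noteq> {}" and Mi: "\<And>g. g \<in> G \<Longrightarrow> actP g ` M \<subseteq> M"
    and Mmin: "\<And>N. closedin ?P N \<Longrightarrow> N \<noteq> {} \<Longrightarrow> (\<And>g. g \<in> G \<Longrightarrow> actP g ` N \<subseteq> N) \<Longrightarrow> N \<subseteq> M \<Longrightarrow> N = M"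
    using M(2) by (auto simp: minimal_closed_G_subset_def)
  have Mi': "act g (x i) \<in> (\<lambda>x. x i) ` M" if "g \<in> G" "x \<in> M" "i \<in> I" for g x i
    using Mi[OF that(1)] that by (auto simp: actP_def image_iff intro!: bexI[of _ "actP g x"])
  have proj: "is_singleton ((\<lambda>x. x i) ` M)" if i: "i \<in> I" for i
  proof (rule min)
    show "minimal_closed_G_subset G Y act ((\<lambda>x. x i) ` M)"
      unfolding minimal_closed_G_subset_def
    proof (intro conjI allI impI ballI)
      have "compactin Y ((\<lambda>x. x i) ` M)"
        by (rule image_compactin[OF closedin_compact_space[OF compP Mc(1)]
              continuous_map_product_projection[OF i]])
      then show "closedin Y ((\<lambda>x. x i) ` M)" by (rule compactin_imp_closedin[OF Hausdorff_Y])
      show "(\<lambda>x. x i) ` M \<noteq> {}" using Mc by simp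
      show "act g ` (\<lambda>x. x i) ` M \<subseteq> (\<lambda>x. x i) ` M" if "g \<in> G" for g
        using Mi'[OF that _ i] by auto
      fix N assume N: "closedin Y N \<and> N \<noteq> {} \<and> (\<forall>g\<in>G. act g ` N \<subseteq> N) \<and> N \<subseteq> (\<lambda>x. x i) ` M"
      \<comment> \<open>A smaller invariant set \<open>N\<close> in the projection pulls back to a
        non-empty closed invariant part of \<open>M\<close>, which by minimality is all of
        \<open>M\<close>.\<close>
      have "M \<inter> {x \<in> topspace ?P. x i \<in> N} = M"
      proof (rule Mmin)
        show "closedin ?P (M \<inter> {x \<in> topspace ?P. x i \<in> N})"
          using N by (intro closedin_Int Mc
              closedin_continuous_map_preimage[OF continuous_map_product_projection[OF i]]) auto
        show "M \<inter> {x \<in> topspace ?P. x i \<in> N} \<noteq> {}"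
          using N closedin_subset[OF Mc(1)] by blast
        fix g assume g: "g \<in> G"
        have "actP g x i \<in> N" if "x i \<in> N" for x
          using N g that i by (auto simp: actP_def)
        then show "actP g ` (M \<inter> {x \<in> topspace ?P. x i \<in> N}) \<subseteq> M \<inter> {x \<in> topspace ?P. x i \<in> N}"
          using Mi[OF g] closedin_subset[OF Mc(1)] by blast
      qed auto
      then show "N = (\<lambda>x. x i) ` M" using N by blast
    qed
  qed
  have sing: "x i = y i" if "i \<in> I" "x \<in> M" "y \<in> M" for i x y
  proof -
    obtain a where "(\<lambda>x. x i) ` M = {a}"
      using proj[OF \<open>i \<in> I\<close>] unfolding is_singleton_def by blast
    then have "z i = a" if "z \<in> M" for z using that by blast
    from this[OF \<open>x \<in> M\<close>] this[OF \<open>y \<in> M\<close>] show ?thesis by simp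
  qed
  obtain d where d: "d \<in> M" using Mc by blast
  \<comment> \<open>Both sides are \<open>i\<close>-th coordinates of points of \<open>M\<close>, so
    \<open>sing\<close> makes them equal.\<close>
  have "act g (d i) = d i" if "i \<in> I" "g \<in> G" for i g
    using Mi'[OF that(2) d that(1)] sing[OF that(1) _ d] by fastforce
  moreover have "d \<in> ?P closure_of {\<lambda>i\<in>I. act g (c i) | g. g \<in> G}"
    using d M(1) by (auto simp: Z_def orb_def actP_def)
  ultimately show ?thesis by blast
qed


text \<open>\<open>M\<close> is itself a compact G-space, so it contains a fixed point
  \<open>p\<close>, and \<open>{p}\<close> is a closed invariant subset of the minimal set
  \<open>M\<close>. The fixed point comes from \<open>extremely_amenable_fixed_point\<close>, since
  the points of \<open>Y\<close> may have any type.\<close>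

lemma minimal_closed_G_subset_is_singleton:
  assumes "extremely_amenable \<Gamma> T" and M: "minimal_closed_G_subset G Y act M"
  shows "is_singleton M"
proof -
  have M_closed: "closedin Y M" and M_ne: "M \<noteq> {}" and M_inv: "\<And>g. g \<in> G \<Longrightarrow> act g ` M \<subseteq> M"
    using M by (auto simp: minimal_closed_G_subset_def)
  interpret M: compact_G_space \<Gamma> T "subtopology Y M" act
    by (rule subspace[OF M_closed M_inv])
  have top: "topspace (subtopology Y M) = M"
    using closedin_subset[OF M_closed] by auto
  obtain p where p: "p \<in> M" "\<forall>g\<in>G. act g p = p"
    using extremely_amenable_fixed_point[OF assms(1) group_\<Gamma> topspace_T M.compact_Y M.Hausdorff_Y _
        M.G_space] M_ne unfolding top by blast
  have "closedin Y {p}"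
    using p(1) closedin_subset[OF M_closed] by (auto simp: closedin_Hausdorff_sing_eq Hausdorff_Y)
  then have "{p} = M"
    using M p unfolding minimal_closed_G_subset_def by simp
  then show ?thesis by (metis is_singletonI)
qed

text \<open>Disjoint neighbourhoods of \<open>y\<close> and \<open>act k y\<close> pull back along
  the action at \<open>(1, y)\<close> and at \<open>(k, y)\<close>; intersecting the two resulting
  neighbourhoods of \<open>y\<close> gives a single \<open>P\<close>.\<close>

lemma separation_of_moved_point:
  assumes y: "y \<in> topspace Y" and k: "k \<in> G" "act k y \<noteq> y"
  shows "\<exists>P N N'. openin Y P \<and> y \<in> P \<and> openin T N \<and> \<one>\<^bsub>\<Gamma>\<^esub> \<in> N \<and> openin T N' \<and> k \<in> N' \<and>
           (\<forall>h\<in>N. \<forall>h'\<in>N'. \<forall>z\<in>P. \<forall>z'\<in>P. act h z \<noteq> act h' z')"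
proof -
  have one: "\<one>\<^bsub>\<Gamma>\<^esub> \<in> G" using group_\<Gamma> by (simp add: group.is_monoid)
  obtain U U' where U: "openin Y U" "openin Y U'" "y \<in> U" "act k y \<in> U'" "disjnt U U'"
    using Hausdorff_Y y act_in[OF k(1) y] k(2) unfolding Hausdorff_space_def by metis
  obtain N P where NP: "openin T N" "openin Y P" "\<one>\<^bsub>\<Gamma>\<^esub> \<in> N" "y \<in> P" "\<forall>h\<in>N. \<forall>z\<in>P. act h z \<in> U"
    using neighbourhoods_of_action[OF U(1) one y] U(3) act_one[OF y] by metis
  obtain N' P' where NP': "openin T N'" "openin Y P'" "k \<in> N'" "y \<in> P'" "\<forall>h\<in>N'. \<forall>z\<in>P'. act h z \<in> U'"
    using neighbourhoods_of_action[OF U(2) k(1) y U(4)] by metis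
  have "\<forall>h\<in>N. \<forall>h'\<in>N'. \<forall>z\<in>P \<inter> P'. \<forall>z'\<in>P \<inter> P'. act h z \<noteq> act h' z'"
    using NP(5) NP'(5) U(5) by (metis IntD1 IntD2 disjnt_iff)
  moreover have "openin Y (P \<inter> P')" using NP NP' by blast
  ultimately show ?thesis using NP NP' by blast
qed

end


section \<open>Graphs of homeomorphisms\<close>

lemma graph_mult: "f ` topspace X \<subseteq> topspace X \<Longrightarrow> graph_action h (graph X f) = graph X (h \<circ> f)"
  by (auto simp: graph_action_def graph_def)

text \<open>The graph is the image of the compact space \<open>X\<close> under
  \<open>x \<mapsto> (x, f x)\<close>, hence closed in the Hausdorff square.\<close>

lemma graph_in_Exp_set:
  assumes X: "compact_space X" "Hausdorff_space X" "topspace X \<noteq> {}" and f: "continuous_map X X f"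
  shows "graph X f \<in> Exp_set (prod_topology X X)"
proof -
  have "continuous_map X (prod_topology X X) (\<lambda>x. (x, f x))"
    using f by (intro continuous_map_pairedI) auto
  then have "compactin (prod_topology X X) ((\<lambda>x. (x, f x)) ` topspace X)"
    using X(1) by (intro image_compactin) (auto simp: compact_space_def)
  moreover have "(\<lambda>x. (x, f x)) ` topspace X = graph X f" by (auto simp: graph_def)
  moreover have "Hausdorff_space (prod_topology X X)"
    unfolding Hausdorff_space_prod_topology using X(2) by blast
  ultimately have "closedin (prod_topology X X) (graph X f)"
    by (metis compactin_imp_closedin)
  then show ?thesis using X(3) by (auto simp: Exp_set_def graph_def)
qed

locale homeomorphism_subgroup =
  fixes X :: "'a topology" and G :: "('a \<Rightarrow> 'a) set"
  assumes compact_X: "compact_space X" and Hausdorff_X: "Hausdorff_space X"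
    and nonempty_X: "topspace X \<noteq> {}" and subgroup_G: "subgroup G (homeo_group X)"
begin

text \<open>Only the carrier is changed, so products and unit are those of
  \<open>homeo_group X\<close> and are written that way below. The inverse depends on the carrier
  and is taken in \<Gamma>.\<close>

abbreviation "\<Gamma> \<equiv> homeo_group X\<lparr>carrier := G\<rparr>"

abbreviation "T \<equiv> subtopology (compact_open_topology X) G"

lemma group_\<Gamma>: "group \<Gamma>"
  by (rule group.subgroup_imp_group[OF group_homeo_group subgroup_G])

lemma G_sub: "G \<subseteq> carrier (homeo_group X)"
  by (rule subgroup.subset[OF subgroup_G])

lemma topspace_T: "topspace T = G"
  using G_sub by (auto simp: topspace_compact_open_topology)

lemma continuous_of_homeo: "f \<in> carrier (homeo_group X) \<Longrightarrow> continuous_map X X f"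
  by (simp add: homeo_group_def homeomorphic_imp_continuous_map)

lemma homeo_in: "f \<in> carrier (homeo_group X) \<Longrightarrow> x \<in> topspace X \<Longrightarrow> f x \<in> topspace X"
  using continuous_map_funspace[OF continuous_of_homeo] by blast

lemma mult_apply:
  "f \<in> G \<Longrightarrow> g \<in> G \<Longrightarrow> x \<in> topspace X \<Longrightarrow> (f \<otimes>\<^bsub>homeo_group X\<^esub> g) x = f (g x)"
  using G_sub by (auto simp: homeo_group_def BijGroup_def compose_def)

lemma one_apply: "x \<in> topspace X \<Longrightarrow> \<one>\<^bsub>homeo_group X\<^esub> x = x"
  by (simp add: homeo_group_def BijGroup_def)

lemma graph_mult_G:
  assumes "h \<in> G" "g \<in> G"
  shows "graph_action h (graph X g) = graph X (h \<otimes>\<^bsub>homeo_group X\<^esub> g)"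
proof -
  have "g ` topspace X \<subseteq> topspace X" using assms G_sub homeo_in by blast
  then have "graph_action h (graph X g) = graph X (h \<circ> g)" by (rule graph_mult)
  also have "\<dots> = graph X (h \<otimes>\<^bsub>homeo_group X\<^esub> g)"
    using assms by (auto simp: graph_def mult_apply)
  finally show ?thesis .
qed

section \<open>The actions on the space, on closed subsets of its square and on the closure of the
  graphs\<close>

text \<open>The point is joint continuity of evaluation. By regularity, \<open>x\<close> has a
  closed, hence compact, neighbourhood \<open>C\<close> that \<open>g\<close> maps into
  \<open>U\<close>; the maps sending \<open>C\<close> into \<open>U\<close> form a compact-open
  neighbourhood of \<open>g\<close>.\<close>

lemma compact_G_space_X: "compact_G_space \<Gamma> T X (\<lambda>g x. g x)"
proof (rule compact_G_space.intro)
  show "G_space \<Gamma> T X (\<lambda>g x. g x)"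
    unfolding G_space_def
  proof (intro conjI ballI)
    show "continuous_map (prod_topology T X) X (\<lambda>(g, x). g x)"
      unfolding continuous_map_def
    proof (intro conjI allI impI)
      show "(\<lambda>(g, x). g x) \<in> topspace (prod_topology T X) \<rightarrow> topspace X"
        using G_sub homeo_in by (auto simp: topspace_compact_open_topology)
      fix U assume U: "openin X U"
      show "openin (prod_topology T X) {p \<in> topspace (prod_topology T X). (\<lambda>(g, x). g x) p \<in> U}"
        unfolding openin_prod_topology_alt
      proof (intro allI impI)
        fix g x assume "(g, x) \<in> {p \<in> topspace (prod_topology T X). (\<lambda>(g, x). g x) p \<in> U}"
        then have g: "g \<in> G" and x: "x \<in> topspace X" "g x \<in> U" using topspace_T by auto
        have "openin X {y \<in> topspace X. g y \<in> U}"
          using g G_sub by (intro openin_continuous_map_preimage[OF continuous_of_homeo U]) auto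
        moreover have "neighbourhood_base_of (closedin X) X"
          unfolding neighbourhood_base_of_closedin
          by (rule compact_Hausdorff_imp_regular_space[OF compact_X Hausdorff_X])
        ultimately obtain P C where PC: "openin X P" "closedin X C" "x \<in> P" "P \<subseteq> C"
          "C \<subseteq> {y \<in> topspace X. g y \<in> U}"
          using x unfolding neighbourhood_base_of by (metis (no_types, lifting) mem_Collect_eq)
        define N where "N = {f \<in> carrier (homeo_group X). f ` C \<subseteq> U}"
        have "openin (compact_open_topology X) N"
          unfolding N_def compact_open_topology_def
          using closedin_compact_space[OF compact_X PC(2)] U
          by (intro topology_generated_by_Basis) blast
        then have "openin T (G \<inter> N)" by (simp add: openin_subtopology_Int2)
        moreover have "(G \<inter> N) \<times> P \<subseteq> {p \<in> topspace (prod_topology T X). (\<lambda>(g, x). g x) p \<in> U}"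
          using PC(4) openin_subset[OF PC(1)] topspace_T by (auto simp: N_def image_subset_iff)
        moreover have "g \<in> G \<inter> N" using g G_sub PC(5) by (auto simp: N_def)
        ultimately show "\<exists>N P. openin T N \<and> openin X P \<and> g \<in> N \<and> x \<in> P \<and>
            N \<times> P \<subseteq> {p \<in> topspace (prod_topology T X). (\<lambda>(g, x). g x) p \<in> U}"
          using PC(1,3) by blast
      qed
    qed
  qed (simp_all add: mult_apply one_apply)
  show "topspace T = carrier \<Gamma>" using topspace_T by simp
qed (rule group_\<Gamma> compact_X Hausdorff_X)+

lemma compact_G_space_Exp_square: "compact_G_space \<Gamma> T (Exp (prod_topology X X)) graph_action"
proof -
  have "(graph_action :: ('a \<Rightarrow> 'a) \<Rightarrow> _) = Exp_action (\<lambda>g (x, y). (x, g y))"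
    by (intro ext) (auto simp: graph_action_def Exp_action_def)
  then show ?thesis
    using compact_G_space.Exp_space[OF compact_G_space.product_with_trivial_action[OF
          compact_G_space_X compact_X Hausdorff_X]] by simp
qed

lemma graphs_in_Exp_square: "graph X ` G \<subseteq> topspace (Exp (prod_topology X X))"
  using graph_in_Exp_set[OF compact_X Hausdorff_X nonempty_X] continuous_of_homeo G_sub
  by (auto simp: topspace_Exp)

text \<open>Translating the graph of \<open>g\<close> by \<open>h\<close> gives the graph of the
  product, so the set of graphs is invariant, and its closure is too.\<close>

lemma compact_G_space_graph_space: "compact_G_space \<Gamma> T (graph_space X G) graph_action"
  unfolding graph_space_def
proof (rule compact_G_space.subspace[OF compact_G_space_Exp_square])
  show "closedin (Exp (prod_topology X X)) (graph_closure X G)"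
    by (simp add: graph_closure_def)
  fix g assume g: "g \<in> carrier \<Gamma>"
  then have "graph_action g ` graph X ` G \<subseteq> graph X ` G"
    using subgroup.m_closed[OF subgroup_G] by (auto simp: graph_mult_G)
  then show "graph_action g ` graph_closure X G \<subseteq> graph_closure X G"
    unfolding graph_closure_def
    by (rule compact_G_space.closure_invariant[OF compact_G_space_Exp_square g])
qed

lemma graphs_in_graph_space: "graph X ` G \<subseteq> topspace (graph_space X G)"
  using graphs_in_Exp_square closure_of_subset[OF graphs_in_Exp_square]
  by (auto simp: graph_space_def graph_closure_def)

section \<open>Comparison of the Vietoris and compact-open topologies\<close>

text \<open>Induction over the generation of compact-open sets. On the subbase, \<open>f\<close>
  maps \<open>K\<close> into \<open>U\<close> exactly when its graph avoids the closed set
  \<open>K \<times> (topspace X - U)\<close>, which is a Vietoris open condition.\<close>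

lemma open_set_of_graphs:
  assumes "openin (compact_open_topology X) N"
  shows "\<exists>Q. openin (Exp (prod_topology X X)) Q \<and> {f \<in> carrier (homeo_group X). graph X f \<in> Q} = N"
proof -
  let ?H = "carrier (homeo_group X)"
  have "generate_topology_on {{f \<in> ?H. f ` K \<subseteq> U} | K U. compactin X K \<and> openin X U} N"
    using assms unfolding compact_open_topology_def by (rule openin_topology_generated_by)
  then show ?thesis
  proof induction
    case Empty
    show ?case by (intro exI[of _ "{}"]) auto
  next
    case (Int a b)
    then obtain Q Q' where "openin (Exp (prod_topology X X)) Q" "{f \<in> ?H. graph X f \<in> Q} = a"
      "openin (Exp (prod_topology X X)) Q'" "{f \<in> ?H. graph X f \<in> Q'} = b" by blast
    then show ?case by (intro exI[of _ "Q \<inter> Q'"]) auto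
  next
    case (UN \<K>)
    then have "\<forall>k\<in>\<K>. \<exists>Q. openin (Exp (prod_topology X X)) Q \<and> {f \<in> ?H. graph X f \<in> Q} = k" by blast
    from bchoice[OF this] obtain Q where
      Q: "\<forall>k\<in>\<K>. openin (Exp (prod_topology X X)) (Q k) \<and> {f \<in> ?H. graph X f \<in> Q k} = k" ..
    have "{f \<in> ?H. graph X f \<in> \<Union>(Q ` \<K>)} = (\<Union>k\<in>\<K>. {f \<in> ?H. graph X f \<in> Q k})" by blast
    also have "\<dots> = (\<Union>k\<in>\<K>. k)" by (rule SUP_cong) (use Q in auto)
    finally show ?case using Q by (intro exI[of _ "\<Union>(Q ` \<K>)"]) auto
  next
    case (Basis s)
    then obtain K U where s: "s = {f \<in> ?H. f ` K \<subseteq> U}" and K: "compactin X K" and U: "openin X U"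
      by blast
    define V where "V = topspace (prod_topology X X) - K \<times> (topspace X - U)"
    have "closedin X K" using K by (simp add: compactin_imp_closedin Hausdorff_X)
    then have "openin (prod_topology X X) V"
      unfolding V_def using U by (intro openin_diff openin_topspace)
        (auto simp: closedin_prod_Times_iff)
    moreover have "graph X f \<subseteq> V \<longleftrightarrow> f ` K \<subseteq> U" if "f \<in> ?H" for f
      using homeo_in[OF that] compactin_subset_topspace[OF K] by (auto simp: graph_def V_def)
    ultimately show ?case
      using graph_in_Exp_set[OF compact_X Hausdorff_X nonempty_X continuous_of_homeo]
      by (intro exI[of _ "{A \<in> Exp_set (prod_topology X X). A \<subseteq> V}"])
        (auto simp: s openin_Exp_subset)
  qed
qed

lemma open_set_of_graphs_in_graph_space:
  assumes "openin T N"
  shows "\<exists>Q. openin (graph_space X G) Q \<and> {g \<in> G. graph X g \<in> Q} = N"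
proof -
  obtain N' where N': "openin (compact_open_topology X) N'" "N = N' \<inter> G"
    using assms by (auto simp: openin_subtopology)
  obtain Q where Q: "openin (Exp (prod_topology X X)) Q" "{f \<in> carrier (homeo_group X). graph X f \<in> Q} = N'"
    using open_set_of_graphs[OF N'(1)] by blast
  have "openin (graph_space X G) (Q \<inter> graph_closure X G)"
    unfolding graph_space_def using Q(1) by (auto simp: openin_subtopology)
  moreover have "graph X g \<in> graph_closure X G" if "g \<in> G" for g
    using graphs_in_graph_space that by (auto simp: graph_space_def)
  ultimately show ?thesis
    using G_sub Q(2) N'(2) by (intro exI[of _ "Q \<inter> graph_closure X G"]) auto
qed

section \<open>From singleton minimal sets to fixed points\<close>

text \<open>Why \<open>Exp R\<close> can test every compact G-space: sorting the elements
  \<open>g\<close> of the group by the position of \<open>inv g\<close> applied to a base point cuts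
  the group into finitely many, possibly overlapping, pieces, and the closures of the non-empty
  pieces in \<open>R\<close> are points of \<open>Exp R\<close>.\<close>

lemma fixed_point_if_minimal_subsets_singletons:
  assumes min: "\<And>M. minimal_closed_G_subset G (Exp (graph_space X G)) (Exp_action graph_action) M
      \<Longrightarrow> is_singleton M"
    and Y: "compact_G_space \<Gamma> T Y act" "topspace Y \<noteq> {}"
  shows "\<exists>p\<in>topspace Y. \<forall>g\<in>G. act g p = p"
proof (rule ccontr)
  interpret Y: compact_G_space \<Gamma> T Y act by (rule Y(1))
  interpret R: compact_G_space \<Gamma> T "graph_space X G" graph_action
    by (rule compact_G_space_graph_space)
  interpret E: compact_G_space \<Gamma> T "Exp (graph_space X G)" "Exp_action graph_action"
    by (rule R.Exp_space)
  interpret \<Gamma>: group \<Gamma> by (rule group_\<Gamma>)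
  let ?R = "graph_space X G"
  let ?one = "\<one>\<^bsub>homeo_group X\<^esub>"
  have inv_in: "inv\<^bsub>\<Gamma>\<^esub> g \<in> G" if "g \<in> G" for g using \<Gamma>.inv_closed[of g] that by simp
  have mult_in: "g \<otimes>\<^bsub>homeo_group X\<^esub> h \<in> G" if "g \<in> G" "h \<in> G" for g h
    using \<Gamma>.m_closed[of g h] that by simp
  have one_in: "?one \<in> G" using \<Gamma>.one_closed by simp
  assume no_fix: "\<not> ?thesis"
  define separated where "separated y k P N N' \<longleftrightarrow> k \<in> G \<and> openin Y P \<and> y \<in> P \<and>
      openin T N \<and> ?one \<in> N \<and> openin T N' \<and> k \<in> N' \<and>
      (\<forall>h\<in>N. \<forall>h'\<in>N'. \<forall>z\<in>P. \<forall>z'\<in>P. act h z \<noteq> act h' z')" for y k P N N'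
  have "\<forall>y\<in>topspace Y. \<exists>k P N N'. separated y k P N N'"
  proof
    fix y assume y: "y \<in> topspace Y"
    then obtain k where "k \<in> G" "act k y \<noteq> y" using no_fix by blast
    then show "\<exists>k P N N'. separated y k P N N'"
      unfolding separated_def using Y.separation_of_moved_point[OF y, of k] by (intro exI[of _ k]) simp
  qed
  then obtain k P N N' where "\<And>y. y \<in> topspace Y \<Longrightarrow> separated y (k y) (P y) (N y) (N' y)"
    by metis
  then have k: "\<And>y. y \<in> topspace Y \<Longrightarrow> k y \<in> G"
    and P: "\<And>y. y \<in> topspace Y \<Longrightarrow> openin Y (P y)" "\<And>y. y \<in> topspace Y \<Longrightarrow> y \<in> P y"
    and N: "\<And>y. y \<in> topspace Y \<Longrightarrow> openin T (N y)" "\<And>y. y \<in> topspace Y \<Longrightarrow> ?one \<in> N y"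
    and N': "\<And>y. y \<in> topspace Y \<Longrightarrow> openin T (N' y)" "\<And>y. y \<in> topspace Y \<Longrightarrow> k y \<in> N' y"
    and sep: "\<And>y h h' z z'. y \<in> topspace Y \<Longrightarrow> h \<in> N y \<Longrightarrow> h' \<in> N' y \<Longrightarrow> z \<in> P y \<Longrightarrow> z' \<in> P y
        \<Longrightarrow> act h z \<noteq> act h' z'"
    by (simp_all add: separated_def)
  \<comment> \<open>The finite cover is indexed by points \<open>j\<close> of \<open>Y\<close>, each
    bringing along its own \<open>k j\<close>, \<open>P j\<close>, \<open>N j\<close> and
    \<open>N' j\<close>.\<close>
  obtain F where F: "finite F" "F \<subseteq> topspace Y" "topspace Y \<subseteq> \<Union>(P ` F)"
  proof -
    have "\<forall>U\<in>P ` topspace Y. openin Y U" "topspace Y \<subseteq> \<Union>(P ` topspace Y)" using P by auto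
    then have "\<exists>\<F>. finite \<F> \<and> \<F> \<subseteq> P ` topspace Y \<and> topspace Y \<subseteq> \<Union>\<F>"
      using Y.compact_Y[unfolded compact_space_alt, rule_format, of "P ` topspace Y"] by simp
    then obtain \<F> where "finite \<F>" "\<F> \<subseteq> P ` topspace Y" and cover: "topspace Y \<subseteq> \<Union>\<F>" by blast
    then obtain F where "finite F" "F \<subseteq> topspace Y" "\<F> = P ` F" by (meson finite_subset_image)
    with cover show thesis by (intro that[of F]) auto
  qed
  obtain y0 where y0: "y0 \<in> topspace Y" using Y(2) by blast
  \<comment> \<open>The inverse is what makes left translation harmless: \<open>h g\<close> applied
    to \<open>inv g\<close> applied to \<open>y0\<close> is \<open>h y0\<close> for every
    \<open>g\<close>, while \<open>inv g\<close> applied to \<open>y0\<close> stays in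
    \<open>P j\<close>.\<close>
  define A where "A j = {g \<in> G. act (inv\<^bsub>\<Gamma>\<^esub> g) y0 \<in> P j}" for j
  define C where "C j = ?R closure_of (graph X ` A j)" for j
  \<comment> \<open>Indices with empty \<open>A j\<close> are dropped because the empty set is not a
    point of \<open>Exp\<close>.\<close>
  define I where "I = {j \<in> F. A j \<noteq> {}}"
  have I: "finite I" "I \<subseteq> topspace Y" using F by (auto simp: I_def)
  have A_sub: "graph X ` A j \<subseteq> topspace ?R" for j
    using graphs_in_graph_space by (auto simp: A_def)
  have C_sup: "graph X ` A j \<subseteq> C j" for j unfolding C_def by (rule closure_of_subset[OF A_sub])
  have C: "C j \<in> topspace (Exp ?R)" if "j \<in> I" for j
    using C_sup[of j] that by (auto simp: topspace_Exp Exp_set_def I_def C_def)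
  let ?P = "product_topology (\<lambda>_. Exp ?R) I"
  let ?orb = "{\<lambda>i\<in>I. Exp_action graph_action g (C i) | g. g \<in> G}"
  obtain d where d: "d \<in> ?P closure_of ?orb"
    and d_fix: "\<And>i g. i \<in> I \<Longrightarrow> g \<in> G \<Longrightarrow> graph_action g ` d i = d i"
    using E.common_limit_of_fixed_points[of I C] min C unfolding Exp_action_eq_image by auto
  have d_top: "d \<in> topspace ?P" using d by (simp add: in_closure_of)
  then have d_Exp: "d i \<in> Exp_set ?R" if "i \<in> I" for i using that by (auto simp: topspace_Exp)
  have approx: "\<exists>h\<in>G. (\<lambda>i\<in>I. graph_action h ` C i) \<in> W" if "openin ?P W" "d \<in> W" for W
    using d that unfolding in_closure_of Exp_action_eq_image by blast
  have "\<exists>j\<in>I. graph X ?one \<in> d j"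
  proof (rule ccontr)
    assume neg: "\<not> (\<exists>j\<in>I. graph X ?one \<in> d j)"
    \<comment> \<open>If every \<open>d i\<close> missed the graph of the identity, then,
      \<open>I\<close> being finite, the translates of all \<open>C i\<close> by one suitable
      \<open>h\<close> would miss it too.\<close>
    let ?S = "{E \<in> Exp_set ?R. E \<subseteq> topspace ?R - {graph X ?one}}"
    have "graph X ?one \<in> topspace ?R" using graphs_in_graph_space one_in by blast
    then have "closedin ?R {graph X ?one}"
      by (simp add: closedin_Hausdorff_sing_eq R.Hausdorff_Y)
    then have "openin (Exp ?R) ?S" by (intro openin_Exp_subset openin_diff openin_topspace)
    then have "openin ?P (PiE I (\<lambda>_. ?S))" by (simp add: openin_PiE I(1))
    moreover have "d \<in> PiE I (\<lambda>_. ?S)"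
    proof (rule PiE_I)
      show "d i \<in> ?S" if "i \<in> I" for i
      proof -
        have "d i \<subseteq> topspace ?R" using d_Exp[OF that] by (simp add: Exp_set_def closedin_subset)
        then show ?thesis using d_Exp[OF that] neg that by blast
      qed
      show "d i = undefined" if "i \<notin> I" for i
        using d_top that unfolding topspace_product_topology by (rule PiE_arb)
    qed
    ultimately obtain h where h: "h \<in> G" "(\<lambda>i\<in>I. graph_action h ` C i) \<in> PiE I (\<lambda>_. ?S)"
      using approx[of "PiE I (\<lambda>_. ?S)"] by blast
    have "act h y0 \<in> topspace Y" using Y.act_in[of h y0] h(1) y0 by simp
    then obtain j where j: "j \<in> F" "act h y0 \<in> P j" using F(3) by blast
    \<comment> \<open>The inverse of \<open>inv h\<close> is \<open>h\<close>, so membership in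
      \<open>A j\<close> says that \<open>h\<close> moves \<open>y0\<close> into \<open>P j\<close>.
      Translating the graph of \<open>inv h\<close> by \<open>h\<close> then gives the graph of the
      identity.\<close>
    have "inv\<^bsub>\<Gamma>\<^esub> h \<in> A j" using h(1) j(2) inv_in by (simp add: A_def)
    then have "j \<in> I" "graph X (inv\<^bsub>\<Gamma>\<^esub> h) \<in> C j" using j(1) C_sup[of j] by (auto simp: I_def)
    moreover have "graph_action h (graph X (inv\<^bsub>\<Gamma>\<^esub> h)) = graph X ?one"
      using graph_mult_G[OF h(1) inv_in[OF h(1)]] \<Gamma>.r_inv[of h] h(1) by simp
    ultimately have "graph X ?one \<in> graph_action h ` C j" by (metis imageI)
    moreover have "graph_action h ` C j \<in> ?S" using h(2) \<open>j \<in> I\<close> by (auto dest: PiE_mem)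
    ultimately show False by blast
  qed
  then obtain j where j: "j \<in> I" "graph X ?one \<in> d j" by blast
  then have jY: "j \<in> topspace Y" using I(2) by blast
  have "graph_action (k j) (graph X ?one) = graph X (k j)"
    using graph_mult_G[OF k[OF jY] one_in] \<Gamma>.r_one[of "k j"] k[OF jY] by simp
  then have kj: "graph X (k j) \<in> d j" using d_fix[OF j(1) k[OF jY]] j(2) by (metis imageI)
  obtain Q where Q: "openin ?R Q" "{g \<in> G. graph X g \<in> Q} = N j"
    using open_set_of_graphs_in_graph_space[OF N(1)[OF jY]] by blast
  obtain Q' where Q': "openin ?R Q'" "{g \<in> G. graph X g \<in> Q'} = N' j"
    using open_set_of_graphs_in_graph_space[OF N'(1)[OF jY]] by blast
  \<comment> \<open>\<open>d j\<close> contains the graphs of the identity and of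
    \<open>k j\<close>, so it meets both \<open>Q\<close> and \<open>Q'\<close>; every translate of
    \<open>C j\<close> close enough to \<open>d j\<close> does as well.\<close>
  let ?S = "{E \<in> Exp_set ?R. E \<inter> Q \<noteq> {}} \<inter> {E \<in> Exp_set ?R. E \<inter> Q' \<noteq> {}}"
  have "openin (Exp ?R) ?S" by (intro openin_Int openin_Exp_meets Q(1) Q'(1))
  then have "openin ?P {x \<in> topspace ?P. x j \<in> ?S}"
    by (rule openin_continuous_map_preimage[OF continuous_map_product_projection[OF j(1)]])
  moreover have "d \<in> {x \<in> topspace ?P. x j \<in> ?S}"
    using d_top d_Exp[OF j(1)] j(2) kj N(2)[OF jY] N'(2)[OF jY] Q(2) Q'(2) by blast
  ultimately obtain h where h: "h \<in> G" "(\<lambda>i\<in>I. graph_action h ` C i) \<in> {x \<in> topspace ?P. x j \<in> ?S}"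
    using approx[of "{x \<in> topspace ?P. x j \<in> ?S}"] by blast
  \<comment> \<open>A translate of \<open>C j\<close> may meet \<open>V\<close> only in limit
    points, but an open set that meets a closure meets the set itself, which yields an actual graph
    of some \<open>h g\<close> with \<open>g\<close> in \<open>A j\<close>.\<close>
  have meets: "\<exists>g\<in>A j. graph X (h \<otimes>\<^bsub>homeo_group X\<^esub> g) \<in> V"
    if "openin ?R V" "graph_action h ` C j \<inter> V \<noteq> {}" for V
  proof -
    have "graph_action h ` C j \<subseteq> ?R closure_of (graph_action h ` graph X ` A j)"
      unfolding C_def using h(1)
      by (intro continuous_map_image_closure_subset R.continuous_map_act) simp
    then have "V \<inter> ?R closure_of (graph_action h ` graph X ` A j) \<noteq> {}" using that(2) by blast
    then have "V \<inter> graph_action h ` graph X ` A j \<noteq> {}"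
      by (simp add: openin_Int_closure_of_eq_empty that(1))
    then show ?thesis using graph_mult_G[OF h(1)] by (force simp: A_def)
  qed
  have move: "act (h \<otimes>\<^bsub>homeo_group X\<^esub> g) (act (inv\<^bsub>\<Gamma>\<^esub> g) y0) = act h y0" if "g \<in> G" for g
    using Y.act_mult[of h g "act (inv\<^bsub>\<Gamma>\<^esub> g) y0"] Y.act_in[of "inv\<^bsub>\<Gamma>\<^esub> g" y0] Y.act_inv[of g y0]
      h(1) that inv_in[OF that] y0 by simp
  have "graph_action h ` C j \<in> ?S" using h(2) j(1) by simp
  then obtain g g' where g: "g \<in> A j" "graph X (h \<otimes>\<^bsub>homeo_group X\<^esub> g) \<in> Q"
    and g': "g' \<in> A j" "graph X (h \<otimes>\<^bsub>homeo_group X\<^esub> g') \<in> Q'"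
    using meets[OF Q(1)] meets[OF Q'(1)] by blast
  have "h \<otimes>\<^bsub>homeo_group X\<^esub> g \<in> N j" "h \<otimes>\<^bsub>homeo_group X\<^esub> g' \<in> N' j"
    using g g' Q(2) Q'(2) mult_in[OF h(1)] by (auto simp: A_def)
  \<comment> \<open>Separation applies since both inner points lie in \<open>P j\<close>; yet by
    \<open>move\<close> both sides equal \<open>act h y0\<close>.\<close>
  then have "act (h \<otimes>\<^bsub>homeo_group X\<^esub> g) (act (inv\<^bsub>\<Gamma>\<^esub> g) y0)
      \<noteq> act (h \<otimes>\<^bsub>homeo_group X\<^esub> g') (act (inv\<^bsub>\<Gamma>\<^esub> g') y0)"
    using g(1) g'(1) by (intro sep[OF jY]) (auto simp: A_def)
  then show False using move g(1) g'(1) by (simp add: A_def)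
qed

end

theorem theorem1p1:
  fixes X :: "'a topology" and G :: "('a \<Rightarrow> 'a) set"
  assumes "compact_space X" and "Hausdorff_space X" and "topspace X \<noteq> {}"
    and "subgroup G (homeo_group X)"
  shows "extremely_amenable (homeo_group X\<lparr>carrier := G\<rparr>) (subtopology (compact_open_topology X) G) \<longleftrightarrow>
    (\<forall>M. minimal_closed_G_subset G (Exp (graph_space X G)) (Exp_action graph_action) M
          \<longrightarrow> is_singleton M)"
proof -
  interpret homeomorphism_subgroup X G using assms by (rule homeomorphism_subgroup.intro)
  interpret E: compact_G_space \<Gamma> T "Exp (graph_space X G)" "Exp_action graph_action"
    by (rule compact_G_space.Exp_space[OF compact_G_space_graph_space])
  show ?thesis
  proof (intro iffI allI impI)
    fix M assume "extremely_amenable \<Gamma> T"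
      and "minimal_closed_G_subset G (Exp (graph_space X G)) (Exp_action graph_action) M"
    then show "is_singleton M" using E.minimal_closed_G_subset_is_singleton by simp
  next
    assume min: "\<forall>M. minimal_closed_G_subset G (Exp (graph_space X G)) (Exp_action graph_action) M
          \<longrightarrow> is_singleton M"
    show "extremely_amenable \<Gamma> T"
      unfolding extremely_amenable_def
    proof (intro allI impI)
      \<comment> \<open>The definition asks only for spaces over this one type, an instance of the
        lemma, which holds for every type of points.\<close>
      fix Y :: "('a \<Rightarrow> 'a) set set topology" and act
      assume Y: "compact_space Y \<and> Hausdorff_space Y \<and> topspace Y \<noteq> {} \<and> G_space \<Gamma> T Y act"
      then have "compact_G_space \<Gamma> T Y act"
        by (intro compact_G_space.intro group_\<Gamma>) (auto simp: topspace_T[simplified])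
      then show "\<exists>p\<in>topspace Y. \<forall>g\<in>carrier \<Gamma>. act g p = p"
        using fixed_point_if_minimal_subsets_singletons[of Y act] min Y by simp
    qed
  qed
qed

end
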